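(* Let $G=(V,E,m_1,m_2)$ be a finite connected undirected graph with $E=\{e_1,\dots,e_n\}$, $n\ge1$, vertex measure $m_1:V\to(0,\infty)$ and symmetric edge measure $m_2:E\to(0,\infty)$, and let $\omega_0:E\to(0,\infty)$. Let $\omega(t,e)$ be the solution of the weighted Forman Ricci flow $$\frac{d}{dt}\omega(t,e)=-F_\omega(t,e)\,\omega(t,e),\quad t>0,\ e\in E,\qquad \omega(0,e)=\omega_0(e),$$ or, in case $G$ is a tree, the solution of the weighted Lin-Lu-Yau flow $\frac{d}{dt}\omega(t,e)=-\kappa_\omega(t,e)\,\omega(t,e)$, $\omega(0,e)=\omega_0(e)$. Then, as $t\to\infty$, for every $e\in E$ the Forman curvature $F_\omega(t,e)$ (respectively, when $G$ is a tree, the Lin-Lu-Yau curvature $\kappa_\omega(t,e)$) converges to the constant $-\lambda_{\max}(\tilde{\mathbf F})$. Moreover, the limit of the normalized weight $\bar\omega(t,e)=\omega(t,e)/\sum_{h\in E}\omega(t,h)$ exists for every $e\in E$, and $$\lim_{t\to\infty}\bar\omega(t,e)=\frac{c_n(e)}{\sum_{h\in E}c_n(h)}.$$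
   Context: Graphs are simple (no loops or multiple edges). Write $x\sim y$ if $(x,y)\in E$, and $e_i=(u_i,v_i)$. **Weighted Forman curvature** of $e=(u,v)$ for a weight $\omega:E\to(0,\infty)$: $$F_\omega(e)=\frac{m_2(e)}{m_1(u)}+\frac{m_2(e)}{m_1(v)}-\sum_{e'\ni u,\,e'\ne e}\frac{m_2(e')}{m_1(u)}\frac{\omega(e')}{\omega(e)}-\sum_{e'\ni v,\,e'\ne e}\frac{m_2(e')}{m_1(v)}\frac{\omega(e')}{\omega(e)}$$ (sums over edges $e'\in E$; empty sums are $0$). The Forman flow is a linear system and has a unique solution, which is positive for all $t>0$. $F_\omega(t,e)$ and $\kappa_\omega(t,e)$ denote curvatures computed with the weight $\omega(t,\cdot)$. **Weighted Lin-Lu-Yau curvature.** $d_\omega$ is the path distance on $V$ generated by the edge lengths $\omega$. Let $\operatorname{Deg}(x)=\frac1{m_1(x)}\sum_{y\sim x}m_2(x,y)$; for small $\epsilon>0$, $m_x^\epsilon$ is the probability measure with $m_x^\epsilon(x)=1-\epsilon\operatorname{Deg}(x)$, $m_x^\epsilon(y)=\epsilon m_2(x,y)/m_1(x)$ for $y\sim x$, and $0$ otherwise. For $e=(x,y)$, $\kappa_\omega(e)=\lim_{\epsilon\to0^+}\frac1\epsilon\big(1-\frac{W(m_x^\epsilon,m_y^\epsilon)}{d_\omega(x,y)}\big)$, with $W$ the (1-)Wasserstein distance with respect to $d_\omega$. **The matrix $\tilde{\mathbf F}$** is the real symmetric $n\times n$ matrix with $\tilde{\mathbf F}_{ii}=-\big(\frac{m_2(e_i)}{m_1(u_i)}+\frac{m_2(e_i)}{m_1(v_i)}\big)$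 and, for $i\ne j$, $\tilde{\mathbf F}_{ij}=\frac{\sqrt{m_2(e_i)m_2(e_j)}}{m_1(x)}$ if $e_i,e_j$ share the vertex $x$, and $\tilde{\mathbf F}_{ij}=0$ if they share no vertex. $\lambda_{\max}(\tilde{\mathbf F})$ is its largest eigenvalue; it is simple, with a unit (Euclidean norm) eigenvector $\mathbf p_n=(p_{n1},\dots,p_{nn})^T$ having all entries positive. **The coefficients**: $c_n(e_l)=\frac{1}{\sqrt{m_2(e_l)}}\,p_{nl}\sum_{j=1}^n p_{nj}\,\omega_0(e_j)\sqrt{m_2(e_j)}$ for $l=1,\dots,n$. *)

theory Defs
  imports "HOL-Analysis.Analysis"
begin

section \<open>Finite simple graphs\<close>

text \<open>An undirected edge is the two-element set of its endpoints, so an edge function such as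
  \<open>m\<^sub>2\<close> or \<open>\<omega>\<close> is symmetric by its type.\<close>

definition simple_graph :: "'a set \<Rightarrow> 'a set set \<Rightarrow> bool" where
  "simple_graph V E \<longleftrightarrow>
     finite V \<and> (\<forall>e\<in>E. \<exists>u\<in>V. \<exists>v\<in>V. u \<noteq> v \<and> e = {u, v})"

definition walk :: "'a set \<Rightarrow> 'a set set \<Rightarrow> 'a list \<Rightarrow> bool" where
  "walk V E p \<longleftrightarrow> p \<noteq> [] \<and> set p \<subseteq> V \<and> successively (\<lambda>x y. {x, y} \<in> E) p"

definition walk_between :: "'a set \<Rightarrow> 'a set set \<Rightarrow> 'a \<Rightarrow> 'a \<Rightarrow> 'a list \<Rightarrow> bool" where
  "walk_between V E x y p \<longleftrightarrow> walk V E p \<and> hd p = x \<and> last p = y"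

definition connected_graph :: "'a set \<Rightarrow> 'a set set \<Rightarrow> bool" where
  "connected_graph V E \<longleftrightarrow>
     simple_graph V E \<and> V \<noteq> {} \<and> (\<forall>x\<in>V. \<forall>y\<in>V. \<exists>p. walk_between V E x y p)"

definition cycle :: "'a set \<Rightarrow> 'a set set \<Rightarrow> 'a list \<Rightarrow> bool" where
  "cycle V E p \<longleftrightarrow> walk V E p \<and> distinct p \<and> 3 \<le> length p \<and> {last p, hd p} \<in> E"

definition tree :: "'a set \<Rightarrow> 'a set set \<Rightarrow> bool" where
  "tree V E \<longleftrightarrow> connected_graph V E \<and> (\<nexists>p. cycle V E p)"


section \<open>Weighted Forman curvature\<close>

definition forman_curvature ::
  "'a set set \<Rightarrow> ('a \<Rightarrow> real) \<Rightarrow> ('a set \<Rightarrow> real) \<Rightarrow> ('a set \<Rightarrow> real) \<Rightarrow> 'a \<Rightarrow> 'a \<Rightarrow> real" where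
  "forman_curvature E m1 m2 \<omega> u v =
     m2 {u, v} / m1 u + m2 {u, v} / m1 v
     - (\<Sum>e' | e' \<in> E \<and> u \<in> e' \<and> e' \<noteq> {u, v}. m2 e' / m1 u * (\<omega> e' / \<omega> {u, v}))
     - (\<Sum>e' | e' \<in> E \<and> v \<in> e' \<and> e' \<noteq> {u, v}. m2 e' / m1 v * (\<omega> e' / \<omega> {u, v}))"


section \<open>Weighted Lin-Lu-Yau curvature\<close>

definition walk_length :: "('a set \<Rightarrow> real) \<Rightarrow> 'a list \<Rightarrow> real" where
  "walk_length \<omega> p = (\<Sum>i<length p - 1. \<omega> {p ! i, p ! Suc i})"

definition path_dist ::
  "'a set \<Rightarrow> 'a set set \<Rightarrow> ('a set \<Rightarrow> real) \<Rightarrow> 'a \<Rightarrow> 'a \<Rightarrow> real" where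
  "path_dist V E \<omega> x y = (INF p\<in>{p. walk_between V E x y p}. walk_length \<omega> p)"

definition weighted_deg ::
  "'a set set \<Rightarrow> ('a \<Rightarrow> real) \<Rightarrow> ('a set \<Rightarrow> real) \<Rightarrow> 'a \<Rightarrow> real" where
  "weighted_deg E m1 m2 x = 1 / m1 x * (\<Sum>y | {x, y} \<in> E. m2 {x, y})"

text \<open>Measures on the finite vertex set are represented by their point masses. The following is a
  probability measure only for small \<open>\<epsilon> > 0\<close>, which suffices for the limit
  \<open>\<epsilon> \<longrightarrow> 0+\<close> below.\<close>

definition lazy_measure ::
  "'a set set \<Rightarrow> ('a \<Rightarrow> real) \<Rightarrow> ('a set \<Rightarrow> real) \<Rightarrow> real \<Rightarrow> 'a \<Rightarrow> 'a \<Rightarrow> real" where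
  "lazy_measure E m1 m2 \<epsilon> x y =
     (if y = x then 1 - \<epsilon> * weighted_deg E m1 m2 x
      else if {x, y} \<in> E then \<epsilon> * m2 {x, y} / m1 x
      else 0)"

definition couplings ::
  "'a set \<Rightarrow> ('a \<Rightarrow> real) \<Rightarrow> ('a \<Rightarrow> real) \<Rightarrow> ('a \<Rightarrow> 'a \<Rightarrow> real) set" where
  "couplings V \<mu> \<nu> =
     {\<pi>. (\<forall>a\<in>V. \<forall>b\<in>V. 0 \<le> \<pi> a b) \<and>
         (\<forall>a\<in>V. (\<Sum>b\<in>V. \<pi> a b) = \<mu> a) \<and>
         (\<forall>b\<in>V. (\<Sum>a\<in>V. \<pi> a b) = \<nu> b)}"

definition wasserstein ::
  "'a set \<Rightarrow> ('a \<Rightarrow> 'a \<Rightarrow> real) \<Rightarrow> ('a \<Rightarrow> real) \<Rightarrow> ('a \<Rightarrow> real) \<Rightarrow> real" where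
  "wasserstein V d \<mu> \<nu> = (INF \<pi>\<in>couplings V \<mu> \<nu>. \<Sum>a\<in>V. \<Sum>b\<in>V. \<pi> a b * d a b)"

definition lly_curvature ::
  "'a set \<Rightarrow> 'a set set \<Rightarrow> ('a \<Rightarrow> real) \<Rightarrow> ('a set \<Rightarrow> real) \<Rightarrow> ('a set \<Rightarrow> real) \<Rightarrow> 'a \<Rightarrow> 'a \<Rightarrow> real"
  where
  "lly_curvature V E m1 m2 \<omega> x y =
     Lim (at_right 0) (\<lambda>\<epsilon>. 1 / \<epsilon> *
       (1 - wasserstein V (path_dist V E \<omega>) (lazy_measure E m1 m2 \<epsilon> x) (lazy_measure E m1 m2 \<epsilon> y)
            / path_dist V E \<omega> x y))"


section \<open>Ricci flow\<close>

text \<open>Here \<open>K w u v\<close> is the curvature of the edge \<open>{u, v}\<close> for the weight \<open>w\<close>. The differential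
  equation is required for \<open>t > 0\<close>; the initial value is tied to it by continuity on
  \<open>[0, \<infinity>)\<close>.\<close>

definition ricci_flow ::
  "'a set set \<Rightarrow> (('a set \<Rightarrow> real) \<Rightarrow> 'a \<Rightarrow> 'a \<Rightarrow> real) \<Rightarrow>
   ('a set \<Rightarrow> real) \<Rightarrow> (real \<Rightarrow> 'a set \<Rightarrow> real) \<Rightarrow> bool" where
  "ricci_flow E K \<omega>\<^sub>0 \<omega> \<longleftrightarrow>
     (\<forall>e\<in>E. \<omega> 0 e = \<omega>\<^sub>0 e) \<and>
     (\<forall>e\<in>E. continuous_on {0..} (\<lambda>t. \<omega> t e)) \<and>
     (\<forall>u v. {u, v} \<in> E \<longrightarrow> (\<forall>t>0.
        ((\<lambda>s. \<omega> s {u, v}) has_real_derivative - K (\<omega> t) u v * \<omega> t {u, v}) (at t)))"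


section \<open>The matrix of the flow and its largest eigenvalue\<close>

definition eigenvector :: "real ^ 'n ^ 'n \<Rightarrow> real ^ 'n \<Rightarrow> real \<Rightarrow> bool" where
  "eigenvector A x k \<longleftrightarrow> x \<noteq> 0 \<and> A *v x = k *\<^sub>R x"

definition eigenvalue :: "real ^ 'n ^ 'n \<Rightarrow> real \<Rightarrow> bool" where
  "eigenvalue A k \<longleftrightarrow> (\<exists>x. eigenvector A x k)"

definition lambda_max :: "real ^ 'n ^ 'n \<Rightarrow> real" where
  "lambda_max A = Max {k. eigenvalue A k}"

text \<open>The edges are enumerated by \<open>e :: 'n \<Rightarrow> 'a set\<close>. In the diagonal entries \<open>x\<close> ranges over the
  two endpoints of \<open>e i\<close>. Distinct edges of a simple graph share at most one vertex, so the sum in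
  the off-diagonal entries consists of at most one term and is \<open>0\<close> for disjoint edges.\<close>

definition forman_matrix ::
  "('a \<Rightarrow> real) \<Rightarrow> ('a set \<Rightarrow> real) \<Rightarrow> ('n \<Rightarrow> 'a set) \<Rightarrow> real ^ 'n ^ 'n" where
  "forman_matrix m1 m2 e =
     (\<chi> i j. if i = j then - (\<Sum>x\<in>e i. m2 (e i) / m1 x)
             else (\<Sum>x\<in>e i \<inter> e j. sqrt (m2 (e i) * m2 (e j)) / m1 x))"

definition perron_vector :: "real ^ 'n ^ 'n \<Rightarrow> real ^ 'n" where
  "perron_vector A = (THE p. eigenvector A p (lambda_max A) \<and> norm p = 1 \<and> (\<forall>i. 0 < p $ i))"

definition limit_coeff ::
  "('a \<Rightarrow> real) \<Rightarrow> ('a set \<Rightarrow> real) \<Rightarrow> ('n \<Rightarrow> 'a set) \<Rightarrow> ('a set \<Rightarrow> real) \<Rightarrow> 'n::finite \<Rightarrow> real" where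
  "limit_coeff m1 m2 e \<omega>\<^sub>0 l =
     (let p = perron_vector (forman_matrix m1 m2 e)
      in 1 / sqrt (m2 (e l)) * (p $ l) * (\<Sum>j\<in>UNIV. p $ j * \<omega>\<^sub>0 (e j) * sqrt (m2 (e j))))"

end

theory Submission
  imports Defs
begin

text \<open>As long as the weight is positive, \<open>y l = sqrt (m2 (e l)) * \<omega> (e l)\<close> solves the linear system
  \<open>y' = A y\<close> with \<open>A\<close> the symmetric Forman matrix, whose off-diagonal entries are nonnegative and
  which is irreducible because the graph is connected; nonnegativity off the diagonal also keeps
  the weight positive. By a Perron-Frobenius argument with the Rayleigh quotient the top eigenvalue
  \<open>\<Lambda>\<close> has a unique positive unit eigenvector \<open>p\<close>, and compactness of the unit sphere of \<open>p\<^sup>\<bottom>\<close> yields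
  a spectral gap, so that \<open>exp (- \<Lambda> t) y(t)\<close> tends to \<open>(p \<bullet> y(0)) p\<close>. Both limits are read off from
  this one. On a tree the two curvatures coincide: an explicit coupling of the lazy measures
  and the signed distance to an endpoint are optimal in Kantorovich duality.\<close>

section \<open>Symmetric matrices with nonnegative off-diagonal entries\<close>

lemma symmetric_matrix_inner:
  fixes A :: "real ^ 'n ^ 'n"
  assumes "transpose A = A"
  shows "x \<bullet> (A *v y) = (A *v x) \<bullet> y"
  by (metis assms dot_lmul_matrix transpose_matrix_vector)

lemma inner_matrix_vector:
  fixes A :: "real ^ 'n ^ 'n"
  shows "x \<bullet> (A *v y) = (\<Sum>i\<in>UNIV. \<Sum>j\<in>UNIV. A $ i $ j * x $ i * y $ j)"
  by (simp add: inner_vec_def matrix_vector_mult_def sum_distrib_left mult_ac)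

text \<open>Eigenvectors of a symmetric matrix for distinct eigenvalues are orthogonal, hence
  independent, so the dimension bounds their number. Finiteness makes the \<open>Max\<close> in
  \<open>lambda_max\<close> meaningful.\<close>

lemma finite_eigenvalues:
  fixes A :: "real ^ 'n ^ 'n"
  assumes sym: "transpose A = A"
  shows "finite {k. eigenvalue A k}"
proof -
  define v where "v k = (SOME x. eigenvector A x k)" for k
  have v: "eigenvector A (v k) k" if "eigenvalue A k" for k
    using that unfolding eigenvalue_def v_def by (rule someI_ex)
  let ?S = "{k. eigenvalue A k}"
  have ortho: "v k \<bullet> v l = 0" if "k \<in> ?S" "l \<in> ?S" "k \<noteq> l" for k l
  proof -
    have "l * (v k \<bullet> v l) = k * (v k \<bullet> v l)"
      using symmetric_matrix_inner[OF sym, of "v k" "v l"] v[of k] v[of l] that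
      by (simp add: eigenvector_def)
    then show ?thesis using that by simp
  qed
  have nz: "v k \<noteq> 0" if "k \<in> ?S" for k
    using v[of k] that by (simp add: eigenvector_def)
  have "inj_on v ?S"
    using ortho nz by (metis (no_types, lifting) inj_onI inner_eq_zero_iff)
  moreover have "independent (v ` ?S)"
    using ortho nz by (intro pairwise_orthogonal_independent) (auto simp: pairwise_def orthogonal_def)
  ultimately show ?thesis
    using independent_bound finite_image_iff by blast
qed

text \<open>A vector attaining the maximum of the Rayleigh quotient is a zero of the positive
  semidefinite form of \<open>k - A\<close>; moving it in the direction of its residual would otherwise make
  that form negative.\<close>

lemma rayleigh_maximizer_eigen:
  fixes A :: "real ^ 'n ^ 'n"
  assumes sym: "transpose A = A"
    and bound: "\<And>y. y \<bullet> (A *v y) \<le> k * (y \<bullet> y)"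
    and eq: "x \<bullet> (A *v x) = k * (x \<bullet> x)"
  shows "A *v x = k *\<^sub>R x"
proof -
  define L where "L y = k *\<^sub>R y - A *v y" for y
  define v where "v = L x"
  have Lsym: "y \<bullet> L z = L y \<bullet> z" for y z
    by (simp add: L_def inner_diff symmetric_matrix_inner[OF sym])
  have Lpos: "0 \<le> y \<bullet> L y" for y
    using bound[of y] by (simp add: L_def inner_diff)
  have Llin: "L (y + s *\<^sub>R z) = L y + s *\<^sub>R L z" for y z s
    by (simp add: L_def algebra_simps matrix_vector_right_distrib matrix_vector_mult_scaleR)
  have L0: "x \<bullet> L x = 0"
    using eq by (simp add: L_def inner_diff)
  define a b where "a = v \<bullet> v" and "b = v \<bullet> L v"
  have quad: "0 \<le> 2 * s * a + s\<^sup>2 * b" for s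
  proof -
    have "(x + s *\<^sub>R v) \<bullet> L (x + s *\<^sub>R v) = x \<bullet> L x + s * (x \<bullet> L v) + s * (v \<bullet> L x) + s\<^sup>2 * (v \<bullet> L v)"
      by (simp add: Llin inner_add power2_eq_square algebra_simps)
    also have "x \<bullet> L v = a" using Lsym[of x v] by (simp add: a_def v_def)
    finally show ?thesis
      using Lpos[of "x + s *\<^sub>R v"] L0 by (simp add: a_def b_def v_def)
  qed
  have b: "0 \<le> b" using Lpos by (simp add: b_def)
  \<comment> \<open>The quadratic in \<open>s\<close> has its minimum at \<open>- a / b\<close>;
    dividing by \<open>b + 1\<close> instead covers \<open>b = 0\<close> and still gives a negative
    value unless \<open>a = 0\<close>.\<close>
  have "2 * (- a / (b + 1)) * a + (- a / (b + 1))\<^sup>2 * b = - (a\<^sup>2 * (b + 2)) / (b + 1)\<^sup>2"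
    using b by (simp add: field_simps power2_eq_square add_nonneg_eq_0_iff)
  then have "a\<^sup>2 * (b + 2) \<le> 0"
    using quad[of "- a / (b + 1)"] b by (simp add: zero_le_divide_iff divide_le_0_iff)
  then have "a = 0" using b by (simp add: mult_le_0_iff)
  then show ?thesis by (simp add: a_def v_def L_def)
qed

text \<open>The form is continuous and the unit sphere compact, so a maximum is attained;
  homogeneity of degree two carries the bound to all vectors.\<close>

lemma rayleigh_max_exists:
  fixes A :: "real ^ 'n ^ 'n"
  obtains x k where "norm x = 1" "x \<bullet> (A *v x) = k" "\<And>y. y \<bullet> (A *v y) \<le> k * (y \<bullet> y)"
proof -
  have "\<exists>x\<in>sphere 0 1. \<forall>y\<in>sphere 0 1. y \<bullet> (A *v y) \<le> x \<bullet> (A *v x)"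
    by (intro continuous_attains_sup continuous_intros matrix_vector_mult_linear_continuous_on)
      auto
  then obtain x where x: "norm x = 1"
    and max: "\<And>y. norm y = 1 \<Longrightarrow> y \<bullet> (A *v y) \<le> x \<bullet> (A *v x)"
    by auto
  have "y \<bullet> (A *v y) \<le> x \<bullet> (A *v x) * (y \<bullet> y)" for y
  proof (cases "y = 0")
    case False
    have "(y /\<^sub>R norm y) \<bullet> (A *v (y /\<^sub>R norm y)) = y \<bullet> (A *v y) / (y \<bullet> y)"
      by (simp add: matrix_vector_mult_scaleR divide_simps power2_eq_square flip: power2_norm_eq_inner)
    then show ?thesis
      using max[of "y /\<^sub>R norm y"] False by (simp add: pos_divide_le_eq)
  qed simp
  with x that show ?thesis by blast
qed

text \<open>The maximum \<open>k\<close> of the Rayleigh quotient is itself an eigenvalue, and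
  testing the bound on an eigenvector shows that no eigenvalue exceeds \<open>k\<close>. So
  \<open>k\<close> is \<open>lambda_max A\<close>, which gives both claims at once.\<close>

lemma
  fixes A :: "real ^ 'n ^ 'n"
  assumes sym: "transpose A = A"
  shows rayleigh_le_lambda_max: "y \<bullet> (A *v y) \<le> lambda_max A * (y \<bullet> y)"
    and lambda_max_eigenvector_exists: "\<exists>x. eigenvector A x (lambda_max A)"
proof -
  obtain x k where x: "norm x = 1" "x \<bullet> (A *v x) = k"
    and bound: "\<And>y. y \<bullet> (A *v y) \<le> k * (y \<bullet> y)"
    using rayleigh_max_exists[of A] by blast
  have "x \<bullet> x = 1" using x by (simp add: dot_square_norm)
  then have ev: "eigenvector A x k"
    using rayleigh_maximizer_eigen[OF sym bound, of x] x by (auto simp: eigenvector_def)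
  have "l \<le> k" if "eigenvalue A l" for l
  proof -
    from that obtain z where z: "z \<noteq> 0" "A *v z = l *\<^sub>R z"
      unfolding eigenvalue_def eigenvector_def by blast
    then show ?thesis using bound[of z] by simp
  qed
  moreover have "eigenvalue A k" using ev by (auto simp: eigenvalue_def)
  ultimately have "lambda_max A = k"
    unfolding lambda_max_def using finite_eigenvalues[OF sym] by (intro Max_eqI) auto
  then show "y \<bullet> (A *v y) \<le> lambda_max A * (y \<bullet> y)" "\<exists>x. eigenvector A x (lambda_max A)"
    using bound ev by auto
qed

section \<open>Perron-Frobenius theory without a sign condition on the diagonal\<close>

text \<open>A Metzler matrix is one with nonnegative off-diagonal entries. Irreducibility says that
  no nonempty proper set of indices decouples from its complement; by symmetry one of the two
  off-diagonal blocks decides this.\<close>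

locale irreducible_symmetric_metzler =
  fixes A :: "real ^ 'n ^ 'n"
  assumes sym: "transpose A = A"
    and offdiag_nonneg: "\<And>i j. i \<noteq> j \<Longrightarrow> 0 \<le> A $ i $ j"
    and irreducible: "\<And>S. S \<noteq> {} \<Longrightarrow> (\<And>i j. i \<in> S \<Longrightarrow> j \<notin> S \<Longrightarrow> A $ i $ j = 0) \<Longrightarrow> S = UNIV"
begin

text \<open>In a row where \<open>q\<close> vanishes, the eigenvalue equation is a vanishing sum of
  nonnegative terms. Hence the zero set of \<open>q\<close> decouples from its complement, and
  irreducibility makes it empty.\<close>

lemma nonneg_eigenvector_pos:
  assumes ev: "eigenvector A q k" and nn: "\<And>i. 0 \<le> q $ i"
  shows "0 < q $ i"
proof -
  define Z where "Z = {i. q $ i = 0}"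
  have "A $ i $ j = 0" if i: "i \<in> Z" and j: "j \<notin> Z" for i j
  proof -
    have "(\<Sum>j\<in>UNIV. A $ i $ j * q $ j) = (A *v q) $ i"
      by (simp add: matrix_vector_mult_def)
    also have "\<dots> = 0"
      using ev i by (simp add: eigenvector_def Z_def)
    finally have "\<forall>j\<in>UNIV. A $ i $ j * q $ j = 0"
      using i offdiag_nonneg nn
      by (subst (asm) sum_nonneg_eq_0_iff) (auto simp: Z_def, metis mult_eq_0_iff mult_nonneg_nonneg order_refl)
    then show ?thesis using j by (auto simp: Z_def)
  qed
  then have "Z = {} \<or> Z = UNIV" using irreducible[of Z] by blast
  moreover have "Z \<noteq> UNIV"
    using ev by (auto simp: Z_def eigenvector_def vec_eq_iff)
  ultimately show ?thesis
    using nn[of i] by (auto simp: Z_def order_less_le)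
qed

text \<open>Taking absolute values keeps the norm and the diagonal terms of the form and does not
  decrease the off-diagonal ones, so the maximum of the Rayleigh quotient is attained again.\<close>

lemma abs_top_eigenvector:
  assumes ev: "eigenvector A q (lambda_max A)"
  shows "eigenvector A (\<chi> i. \<bar>q $ i\<bar>) (lambda_max A)"
proof -
  let ?r = "\<chi> i. \<bar>q $ i\<bar>"
  have eq: "?r \<bullet> ?r = q \<bullet> q" by (simp add: inner_vec_def)
  have "q \<bullet> (A *v q) \<le> ?r \<bullet> (A *v ?r)"
    unfolding inner_matrix_vector
  proof (intro sum_mono)
    fix i j
    show "A $ i $ j * q $ i * q $ j \<le> A $ i $ j * ?r $ i * ?r $ j"
    proof (cases "i = j")
      case False
      have "q $ i * q $ j \<le> \<bar>q $ i\<bar> * \<bar>q $ j\<bar>"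
        using abs_ge_self[of "q $ i * q $ j"] by (simp add: abs_mult)
      from mult_left_mono[OF this offdiag_nonneg[OF False]] show ?thesis
        by (simp add: mult_ac)
    qed simp
  qed
  moreover have "q \<bullet> (A *v q) = lambda_max A * (q \<bullet> q)"
    using ev by (simp add: eigenvector_def)
  ultimately have "?r \<bullet> (A *v ?r) = lambda_max A * (?r \<bullet> ?r)"
    using rayleigh_le_lambda_max[OF sym, of ?r] eq by simp
  then have "A *v ?r = lambda_max A *\<^sub>R ?r"
    using rayleigh_maximizer_eigen[OF sym rayleigh_le_lambda_max[OF sym]] by blast
  moreover have "?r \<noteq> 0" using ev by (auto simp: eigenvector_def vec_eq_iff)
  ultimately show ?thesis by (simp add: eigenvector_def)
qed

lemma top_eigenvector_nonzero:
  assumes "eigenvector A q (lambda_max A)"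
  shows "q $ i \<noteq> 0"
  using nonneg_eigenvector_pos[OF abs_top_eigenvector[OF assms], of i] by simp

text \<open>Subtracting the multiple of \<open>p\<close> that cancels one coordinate of
  \<open>q\<close> leaves a solution of the eigenvalue equation with a zero entry, which must be the
  zero vector.\<close>

lemma top_eigenvector_unique:
  assumes p: "eigenvector A p (lambda_max A)" and q: "A *v q = lambda_max A *\<^sub>R q"
  shows "\<exists>c. q = c *\<^sub>R p"
proof -
  fix i
  define c where "c = q $ i / p $ i"
  have "A *v (q - c *\<^sub>R p) = lambda_max A *\<^sub>R (q - c *\<^sub>R p)"
    using p q by (simp add: eigenvector_def matrix_vector_mult_diff_distrib
        matrix_vector_mult_scaleR algebra_simps)
  moreover have "(q - c *\<^sub>R p) $ i = 0"
    using top_eigenvector_nonzero[OF p, of i] by (simp add: c_def)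
  ultimately have "q - c *\<^sub>R p = 0"
    using top_eigenvector_nonzero[of "q - c *\<^sub>R p" i] by (auto simp: eigenvector_def)
  then show ?thesis by auto
qed

abbreviation "p \<equiv> perron_vector A"
abbreviation "\<Lambda> \<equiv> lambda_max A"

text \<open>This justifies the definite description in \<open>perron_vector\<close>: the normalized
  absolute value of any top eigenvector qualifies, and two candidates differ by a factor that is
  positive and of modulus one.\<close>

lemma perron_vector:
  "eigenvector A p \<Lambda>" "norm p = 1" "0 < p $ i"
proof -
  obtain q where q: "eigenvector A q \<Lambda>"
    using lambda_max_eigenvector_exists[OF sym] by blast
  define r where "r = (\<chi> i. \<bar>q $ i\<bar>)"
  have r: "eigenvector A r \<Lambda>" unfolding r_def by (rule abs_top_eigenvector[OF q])
  have rpos: "0 < r $ i" for i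
    by (rule nonneg_eigenvector_pos[OF r]) (simp add: r_def)
  have r0: "r \<noteq> 0" using r by (simp add: eigenvector_def)
  let ?P = "\<lambda>p. eigenvector A p \<Lambda> \<and> norm p = 1 \<and> (\<forall>i. 0 < p $ i)"
  have "?P (r /\<^sub>R norm r)"
    using r rpos r0 by (simp add: eigenvector_def matrix_vector_mult_scaleR)
  moreover have "x = y" if x: "?P x" and y: "?P y" for x y
  proof -
    obtain c where c: "x = c *\<^sub>R y"
      using top_eigenvector_unique[of y x] x y by (auto simp: eigenvector_def)
    fix i
    have "x $ i = c * y $ i" using c by simp
    then have "0 < c * y $ i" using x by metis
    then have "0 < c" using y by (metis zero_less_mult_pos2)
    moreover have "\<bar>c\<bar> = 1" using x y c by simp
    ultimately show ?thesis using c by simp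
  qed
  ultimately have "?P p"
    unfolding perron_vector_def by (intro theI[of ?P "r /\<^sub>R norm r"]) blast+
  then show "eigenvector A p \<Lambda>" "norm p = 1" "0 < p $ i" by auto
qed

text \<open>The Rayleigh quotient attains its maximum on the unit vectors orthogonal to
  \<open>p\<close>. Were that maximum \<Lambda>, the maximizer would be a top eigenvector, hence a
  multiple of \<open>p\<close>, and also orthogonal to \<open>p\<close>.\<close>

lemma spectral_gap:
  obtains g where "0 < g" "\<And>r. r \<bullet> p = 0 \<Longrightarrow> r \<bullet> (A *v r) \<le> (\<Lambda> - g) * (r \<bullet> r)"
proof (cases "\<exists>r. r \<bullet> p = 0 \<and> norm r = 1")
  case True
  let ?S = "sphere 0 1 \<inter> {r. r \<bullet> p = 0}"
  have "closed {r. r \<bullet> p = 0}"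
    by (intro closed_Collect_eq continuous_intros)
  then have "\<exists>x\<in>?S. \<forall>y\<in>?S. y \<bullet> (A *v y) \<le> x \<bullet> (A *v x)"
    using True
    by (intro continuous_attains_sup continuous_intros matrix_vector_mult_linear_continuous_on
        compact_Int_closed) auto
  then obtain x where x: "norm x = 1" "x \<bullet> p = 0"
    and max: "\<And>y. norm y = 1 \<Longrightarrow> y \<bullet> p = 0 \<Longrightarrow> y \<bullet> (A *v y) \<le> x \<bullet> (A *v x)"
    by auto
  define g where "g = \<Lambda> - x \<bullet> (A *v x)"
  have xx: "x \<bullet> x = 1" using x by (simp add: dot_square_norm)
  have "x \<bullet> (A *v x) \<noteq> \<Lambda>"
  proof
    assume "x \<bullet> (A *v x) = \<Lambda>"
    then have "A *v x = \<Lambda> *\<^sub>R x"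
      using rayleigh_maximizer_eigen[OF sym rayleigh_le_lambda_max[OF sym]] xx by simp
    then obtain c where c: "x = c *\<^sub>R p" using top_eigenvector_unique perron_vector by blast
    then have "c * (p \<bullet> p) = 0" using x by simp
    then show False using x c by auto
  qed
  then have "0 < g"
    using rayleigh_le_lambda_max[OF sym, of x] xx by (simp add: g_def)
  moreover have "r \<bullet> (A *v r) \<le> (\<Lambda> - g) * (r \<bullet> r)" if "r \<bullet> p = 0" for r
  proof (cases "r = 0")
    case False
    have "(r /\<^sub>R norm r) \<bullet> (A *v (r /\<^sub>R norm r)) = r \<bullet> (A *v r) / (r \<bullet> r)"
      by (simp add: matrix_vector_mult_scaleR divide_simps power2_eq_square flip: power2_norm_eq_inner)
    then show ?thesis
      using max[of "r /\<^sub>R norm r"] that False by (simp add: g_def pos_divide_le_eq)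
  qed simp
  ultimately show ?thesis by (rule that)
next
  \<comment> \<open>In dimension one the orthogonal complement of \<open>p\<close> is zero, and any
    positive gap will do.\<close>
  case False
  have "r = 0" if "r \<bullet> p = 0" for r
  proof (rule ccontr)
    assume "r \<noteq> 0"
    then show False using False that by (auto dest!: spec[of _ "r /\<^sub>R norm r"])
  qed
  then have "r \<bullet> (A *v r) \<le> (\<Lambda> - 1) * (r \<bullet> r)" if "r \<bullet> p = 0" for r
    using that by fastforce
  then show ?thesis using that[of 1] by simp
qed

section \<open>Long-time behaviour of the linear flow\<close>

text \<open>The rescaled solution \<open>z\<close> satisfies \<open>z' = (A - \<Lambda>) z\<close>.
  Its component along \<open>p\<close> is conserved, and the orthogonal remainder \<open>r\<close>
  decays exponentially by the spectral gap.\<close>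

lemma linear_flow_limit:
  fixes y :: "real \<Rightarrow> real ^ 'n"
  assumes cont: "continuous_on {0..} y"
    and ode: "\<And>t. 0 < t \<Longrightarrow> (y has_vector_derivative A *v y t) (at t)"
  shows "((\<lambda>t. exp (- \<Lambda> * t) *\<^sub>R y t) \<longlongrightarrow> (p \<bullet> y 0) *\<^sub>R p) at_top"
proof -
  define z where "z t = exp (- \<Lambda> * t) *\<^sub>R y t" for t
  define r where "r t = z t - (p \<bullet> y 0) *\<^sub>R p" for t
  have eig: "A *v p = \<Lambda> *\<^sub>R p" and pp: "p \<bullet> p = 1"
    using perron_vector by (auto simp: eigenvector_def dot_square_norm)
  have zcont: "continuous_on {0..} z"
    unfolding z_def by (intro continuous_intros cont)
  have zder: "(z has_vector_derivative A *v z t - \<Lambda> *\<^sub>R z t) (at t)" if "0 < t" for t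
    unfolding z_def
    by (rule derivative_eq_intros ode[OF that] refl | simp add: matrix_vector_mult_scaleR algebra_simps)+
  \<comment> \<open>The derivative of \<open>p \<bullet> z t\<close> vanishes because
    \<open>A - \<Lambda>\<close> is symmetric and annihilates \<open>p\<close>. Continuity at
    \<open>0\<close> is needed since the equation holds only for positive times.\<close>
  have pz: "p \<bullet> z t = p \<bullet> y 0" if "0 \<le> t" for t
  proof (cases "t = 0")
    case False
    have "p \<bullet> z t = p \<bullet> z 0"
    proof (rule DERIV_isconst_end[of 0 t "\<lambda>t. p \<bullet> z t"])
      show "0 < t" using False that by simp
      show "continuous_on {0..t} (\<lambda>t. p \<bullet> z t)"
        by (intro continuous_intros continuous_on_subset[OF zcont]) auto
      fix s assume "0 < s" "s < t"
      have "((\<lambda>t. p \<bullet> z t) has_vector_derivative p \<bullet> (A *v z s - \<Lambda> *\<^sub>R z s)) (at s)"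
        by (rule bounded_linear.has_vector_derivative[OF bounded_linear_inner_right zder[OF \<open>0 < s\<close>]])
      also have "p \<bullet> (A *v z s - \<Lambda> *\<^sub>R z s) = 0"
        by (simp add: inner_diff symmetric_matrix_inner[OF sym] eig)
      finally show "((\<lambda>t. p \<bullet> z t) has_real_derivative 0) (at s)"
        by (simp add: has_real_derivative_iff_has_vector_derivative)
    qed
    then show ?thesis by (simp add: z_def)
  qed (simp add: z_def)
  have rp: "r t \<bullet> p = 0" if "0 \<le> t" for t
    using pz[OF that] pp by (simp add: r_def inner_diff inner_commute)
  have rcont: "continuous_on {0..} r"
    unfolding r_def by (intro continuous_intros zcont)
  have rder: "(r has_vector_derivative A *v r t - \<Lambda> *\<^sub>R r t) (at t)" if "0 < t" for t
  proof -
    have "(r has_vector_derivative (A *v z t - \<Lambda> *\<^sub>R z t) - 0) (at t)"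
      unfolding r_def by (intro derivative_intros zder that)
    also have "(A *v z t - \<Lambda> *\<^sub>R z t) - 0 = A *v r t - \<Lambda> *\<^sub>R r t"
      by (simp add: r_def matrix_vector_mult_diff_distrib matrix_vector_mult_scaleR eig algebra_simps)
    finally show ?thesis .
  qed
  obtain g where g: "0 < g" and gap: "\<And>r. r \<bullet> p = 0 \<Longrightarrow> r \<bullet> (A *v r) \<le> (\<Lambda> - g) * (r \<bullet> r)"
    by (rule spectral_gap) blast
  \<comment> \<open>An energy with integrating factor: the gap bounds the derivative of
    \<open>r t \<bullet> r t\<close> by \<open>- 2 * g\<close> times itself, so \<open>h\<close>
    cannot increase.\<close>
  define h where "h t = exp (2 * g * t) * (r t \<bullet> r t)" for t
  have h_le: "h t \<le> h 0" if "0 \<le> t" for t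
  proof (rule DERIV_nonpos_imp_decreasing_open[OF that])
    show "continuous_on {0..t} h"
      unfolding h_def by (intro continuous_intros continuous_on_subset[OF rcont]) auto
    fix s assume s: "0 < s" "s < t"
    have "(r has_derivative (\<lambda>x. x *\<^sub>R (A *v r s - \<Lambda> *\<^sub>R r s))) (at s)"
      using rder[OF s(1)] by (simp add: has_vector_derivative_def)
    from has_derivative_inner[OF this this]
    have "((\<lambda>t. r t \<bullet> r t) has_real_derivative 2 * (r s \<bullet> (A *v r s - \<Lambda> *\<^sub>R r s))) (at s)"
      unfolding has_field_derivative_def
      by (rule has_derivative_eq_rhs) (simp add: fun_eq_iff inner_commute algebra_simps)
    moreover have "((\<lambda>t. exp (2 * g * t)) has_real_derivative exp (2 * g * s) * (2 * g)) (at s)"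
      by (auto intro!: derivative_eq_intros)
    ultimately have "(h has_real_derivative exp (2 * g * s) * (2 * g * (r s \<bullet> r s)
        + 2 * (r s \<bullet> (A *v r s - \<Lambda> *\<^sub>R r s)))) (at s)"
      using DERIV_mult unfolding h_def by (force simp: algebra_simps)
    moreover have "2 * g * (r s \<bullet> r s) + 2 * (r s \<bullet> (A *v r s - \<Lambda> *\<^sub>R r s)) \<le> 0"
      using gap[OF rp, of s] s by (simp add: inner_diff algebra_simps)
    ultimately show "\<exists>D. (h has_real_derivative D) (at s) \<and> D \<le> 0"
      by (meson exp_ge_zero mult_nonneg_nonpos)
  qed
  have "((\<lambda>t. (norm (r t))\<^sup>2) \<longlongrightarrow> 0) at_top"
  proof (rule tendsto_sandwich[of "\<lambda>_. 0" _ _ "\<lambda>t. h 0 * exp (- (2 * g * t))"])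
    show "\<forall>\<^sub>F t in at_top. (norm (r t))\<^sup>2 \<le> h 0 * exp (- (2 * g * t))"
      using eventually_ge_at_top[of 0]
    proof eventually_elim
      case (elim t)
      then show ?case
        using h_le[OF elim] by (simp add: h_def power2_norm_eq_inner exp_minus field_simps)
    qed
    have "LIM t at_top. 2 * g * t :> at_top"
      using g by (intro filterlim_tendsto_pos_mult_at_top[OF tendsto_const] filterlim_ident) auto
    then have "((\<lambda>t. exp (- (2 * g * t))) \<longlongrightarrow> 0) at_top"
      by (intro filterlim_compose[OF exp_at_bot] filterlim_compose[OF filterlim_uminus_at_bot_at_top])
    then show "((\<lambda>t. h 0 * exp (- (2 * g * t))) \<longlongrightarrow> 0) at_top"
      using tendsto_mult_right_zero by blast
  qed auto
  then have "(r \<longlongrightarrow> 0) at_top"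
    using tendsto_real_sqrt by (fastforce simp: tendsto_norm_zero_iff)
  from tendsto_add[OF this tendsto_const, of "(p \<bullet> y 0) *\<^sub>R p"]
  show ?thesis by (simp add: r_def z_def)
qed

end

section \<open>Lin-Lu-Yau curvature of trees\<close>

lemma edgeD:
  assumes "simple_graph V E" "{u, v} \<in> E"
  shows "u \<in> V" "v \<in> V" "u \<noteq> v"
  using assms unfolding simple_graph_def by (metis doubleton_eq_iff insert_absorb2)+

lemma finite_edges: "simple_graph V E \<Longrightarrow> finite E"
  unfolding simple_graph_def by (rule finite_subset[of _ "Pow V"]) auto

lemma finite_neighbours:
  assumes "simple_graph V E"
  shows "finite {z. {x, z} \<in> E}"
  using assms edgeD(2)[OF assms]
  by (intro finite_subset[of "{z. {x, z} \<in> E}" V]) (auto simp: simple_graph_def)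

lemma walk_Cons:
  "p \<noteq> [] \<Longrightarrow> walk V E (x # p) \<longleftrightarrow> x \<in> V \<and> {x, hd p} \<in> E \<and> walk V E p"
  by (auto simp: walk_def successively_Cons)

lemma walk_snoc:
  "p \<noteq> [] \<Longrightarrow> walk V E (p @ [x]) \<longleftrightarrow> x \<in> V \<and> {last p, x} \<in> E \<and> walk V E p"
  by (auto simp: walk_def successively_append_iff)

lemma walk_length_singleton [simp]: "walk_length w [x] = 0"
  by (simp add: walk_length_def)

lemma walk_length_Cons:
  assumes "p \<noteq> []"
  shows "walk_length w (x # p) = w {x, hd p} + walk_length w p"
proof -
  obtain n where "length p = Suc n" using assms by (cases p) auto
  then show ?thesis
    using assms unfolding walk_length_def
    by (simp add: sum.lessThan_Suc_shift hd_conv_nth del: sum.lessThan_Suc)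
qed

text \<open>The increments of \<open>F\<close> telescope along the walk. Potentials bound distances
  from below in this way, and \<open>F = 0\<close> gives nonnegativity of walk lengths.\<close>

lemma walk_lipschitz:
  fixes F :: "'a \<Rightarrow> real"
  assumes lip: "\<And>a b. {a, b} \<in> E \<Longrightarrow> F a - F b \<le> w {a, b}" and "walk V E p"
  shows "F (hd p) - F (last p) \<le> walk_length w p"
  using assms(2)
proof (induction p)
  case (Cons x p)
  show ?case
  proof (cases "p = []")
    case False
    then have "{x, hd p} \<in> E" "walk V E p" using Cons.prems by (simp_all add: walk_Cons)
    then show ?thesis
      using Cons.IH lip[of x "hd p"] False by (simp add: walk_length_Cons)
  qed simp
qed (simp add: walk_def)

text \<open>A shortest walk repeats no vertex, since the segment between two visits could be cut
  out.\<close>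

lemma distinct_walk_exists:
  assumes "walk_between V E x y p"
  obtains q where "walk_between V E x y q" "distinct q"
proof -
  obtain q where q: "walk_between V E x y q"
    and min: "\<And>r. walk_between V E x y r \<Longrightarrow> length q \<le> length r"
    using assms exists_least_iff[of "\<lambda>n. \<exists>q. walk_between V E x y q \<and> length q = n"]
    by (metis not_le_imp_less)
  have "distinct q"
  proof (rule ccontr)
    assume "\<not> distinct q"
    then obtain xs a ys zs where dec: "q = xs @ [a] @ ys @ [a] @ zs"
      using not_distinct_decomp by blast
    have "walk_between V E x y (xs @ [a] @ zs)"
      using q unfolding dec walk_between_def walk_def
      by (cases xs; cases zs)
        (auto simp: successively_append_iff successively_Cons hd_append last_append split: if_splits)
    then show False using min[of "xs @ [a] @ zs"] dec by simp
  qed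
  with q that show ?thesis by blast
qed

section \<open>The path metric\<close>

locale weighted_graph =
  fixes V :: "'a set" and E :: "'a set set" and w :: "'a set \<Rightarrow> real"
  assumes connected: "connected_graph V E"
    and weight_pos: "\<And>h. h \<in> E \<Longrightarrow> 0 < w h"
begin

abbreviation d :: "'a \<Rightarrow> 'a \<Rightarrow> real" where "d \<equiv> path_dist V E w"

lemma simple: "simple_graph V E"
  using connected by (simp add: connected_graph_def)

lemmas edge = edgeD[OF simple]

lemma walk_exists: "a \<in> V \<Longrightarrow> b \<in> V \<Longrightarrow> \<exists>p. walk_between V E a b p"
  using connected by (simp add: connected_graph_def)

lemma walk_length_nonneg: "walk V E p \<Longrightarrow> 0 \<le> walk_length w p"
  using walk_lipschitz[of E "\<lambda>_. 0" w V p] weight_pos by (simp add: less_imp_le)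

lemma dist_le_walk_length: "walk_between V E a b p \<Longrightarrow> d a b \<le> walk_length w p"
  unfolding path_dist_def
  by (rule cINF_lower) (auto simp: walk_between_def intro!: bdd_belowI[of _ 0] walk_length_nonneg)

lemma lipschitz_le_dist:
  fixes F :: "'a \<Rightarrow> real"
  assumes lip: "\<And>a b. {a, b} \<in> E \<Longrightarrow> F a - F b \<le> w {a, b}" and "a \<in> V" "b \<in> V"
  shows "F a - F b \<le> d a b"
  unfolding path_dist_def
proof (rule cINF_greatest)
  show "{p. walk_between V E a b p} \<noteq> {}" using walk_exists assms by blast
  fix p assume "p \<in> {p. walk_between V E a b p}"
  then show "F a - F b \<le> walk_length w p"
    using walk_lipschitz[of E F w V p] lip by (auto simp: walk_between_def)
qed

lemma dist_refl: "a \<in> V \<Longrightarrow> d a a = 0"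
  using dist_le_walk_length[of a a "[a]"] lipschitz_le_dist[of "\<lambda>_. 0" a a] weight_pos
  by (simp add: walk_between_def walk_def less_imp_le)

text \<open>Every walk from \<open>b\<close> to \<open>c\<close> extends to one from
  \<open>a\<close> by prepending the edge; the infimum over these walks then gives the
  bound.\<close>

lemma dist_step:
  assumes ab: "{a, b} \<in> E" and c: "c \<in> V"
  shows "d a c \<le> w {a, b} + d b c"
proof -
  have "d a c - w {a, b} \<le> d b c"
    unfolding path_dist_def[of V E w b c]
  proof (rule cINF_greatest)
    show "{p. walk_between V E b c p} \<noteq> {}" using walk_exists[of b c] c edge[OF ab] by blast
    fix p assume "p \<in> {p. walk_between V E b c p}"
    then have p: "walk V E p" "hd p = b" "last p = c" "p \<noteq> []"
      by (auto simp: walk_between_def walk_def)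
    then have "walk_between V E a c (a # p)"
      using ab edge[OF ab] by (simp add: walk_between_def walk_Cons)
    then show "d a c - w {a, b} \<le> walk_length w p"
      using dist_le_walk_length[of a c "a # p"] p by (simp add: walk_length_Cons)
  qed
  then show ?thesis by simp
qed

end

section \<open>Transport duality and lazy measures\<close>

lemma coupling_sum:
  assumes "\<pi> \<in> couplings V \<mu> \<nu>"
  shows "(\<Sum>a\<in>V. \<Sum>b\<in>V. \<pi> a b * (F a - F b)) = (\<Sum>a\<in>V. F a * \<mu> a) - (\<Sum>b\<in>V. F b * \<nu> b)"
proof -
  have "(\<Sum>a\<in>V. \<Sum>b\<in>V. \<pi> a b * (F a - F b))
      = (\<Sum>a\<in>V. \<Sum>b\<in>V. F a * \<pi> a b) - (\<Sum>b\<in>V. \<Sum>a\<in>V. F b * \<pi> a b)"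
    by (subst (2) sum.swap) (simp add: algebra_simps sum_subtractf)
  also have "\<dots> = (\<Sum>a\<in>V. F a * \<mu> a) - (\<Sum>b\<in>V. F b * \<nu> b)"
    using assms by (simp add: couplings_def flip: sum_distrib_left)
  finally show ?thesis .
qed

text \<open>Kantorovich duality with complementary slackness: the potential \<open>F\<close> bounds
  the cost of every coupling from below, and \<pi> attains the bound because it charges only pairs
  on which cost and potential difference agree.\<close>

lemma wasserstein_eqI:
  assumes lip: "\<And>a b. a \<in> V \<Longrightarrow> b \<in> V \<Longrightarrow> F a - F b \<le> c a b"
    and \<pi>: "\<pi> \<in> couplings V \<mu> \<nu>"
    and tight: "\<And>a b. a \<in> V \<Longrightarrow> b \<in> V \<Longrightarrow> \<pi> a b \<noteq> 0 \<Longrightarrow> c a b \<le> F a - F b"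
  shows "wasserstein V c \<mu> \<nu> = (\<Sum>a\<in>V. F a * \<mu> a) - (\<Sum>b\<in>V. F b * \<nu> b)"
proof -
  let ?m = "(\<Sum>a\<in>V. F a * \<mu> a) - (\<Sum>b\<in>V. F b * \<nu> b)"
  have lower: "?m \<le> (\<Sum>a\<in>V. \<Sum>b\<in>V. \<rho> a b * c a b)" if "\<rho> \<in> couplings V \<mu> \<nu>" for \<rho>
    unfolding coupling_sum[OF that, symmetric] using that lip
    by (intro sum_mono mult_left_mono) (auto simp: couplings_def)
  have "(\<Sum>a\<in>V. \<Sum>b\<in>V. \<pi> a b * c a b) = (\<Sum>a\<in>V. \<Sum>b\<in>V. \<pi> a b * (F a - F b))"
    using lip tight by (intro sum.cong refl) (metis antisym mult_eq_0_iff)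
  also have "\<dots> = ?m" by (rule coupling_sum[OF \<pi>])
  finally have "(\<Sum>a\<in>V. \<Sum>b\<in>V. \<pi> a b * c a b) = ?m" .
  then show ?thesis
    unfolding wasserstein_def using lower \<pi>
    by (intro cInf_eq_minimum) (auto intro!: image_eqI[where x = \<pi>])
qed

text \<open>Leave the common part \<open>\<delta>\<close> in place and couple the remainders independently.\<close>

lemma residual_coupling:
  fixes \<mu> \<nu> \<delta> :: "'a \<Rightarrow> real"
  assumes fin: "finite V"
    and ge: "\<And>a. a \<in> V \<Longrightarrow> 0 \<le> \<delta> a" "\<And>a. a \<in> V \<Longrightarrow> \<delta> a \<le> \<mu> a" "\<And>a. a \<in> V \<Longrightarrow> \<delta> a \<le> \<nu> a"
    and mass: "sum \<mu> V = 1" "sum \<nu> V = 1" "sum \<delta> V < 1"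
  shows "(\<lambda>a b. (if a = b then \<delta> a else 0) + (\<mu> a - \<delta> a) * (\<nu> b - \<delta> b) / (1 - sum \<delta> V))
    \<in> couplings V \<mu> \<nu>"
proof -
  have "(\<Sum>b\<in>V. (\<mu> a - \<delta> a) * (\<nu> b - \<delta> b) / (1 - sum \<delta> V)) = \<mu> a - \<delta> a"
    "(\<Sum>b\<in>V. (\<mu> b - \<delta> b) * (\<nu> a - \<delta> a) / (1 - sum \<delta> V)) = \<nu> a - \<delta> a" for a
    using mass by (simp_all add: sum_subtractf flip: sum_divide_distrib sum_distrib_left sum_distrib_right)
  then show ?thesis
    using assms by (auto simp: couplings_def sum.distrib intro!: add_nonneg_nonneg divide_nonneg_nonneg mult_nonneg_nonneg)
qed

text \<open>The correction to \<open>F x\<close> is \<epsilon> times the weighted graph Laplacian of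
  \<open>F\<close> at \<open>x\<close>. With \<open>F = 1\<close> it vanishes, which gives total
  mass one.\<close>

lemma lazy_measure_sum:
  assumes G: "simple_graph V E" and x: "x \<in> V"
  shows "(\<Sum>a\<in>V. F a * lazy_measure E m1 m2 \<epsilon> x a)
    = F x + \<epsilon> / m1 x * (\<Sum>z | {x, z} \<in> E. m2 {x, z} * (F z - F x))"
proof -
  have fin: "finite V" using G by (simp add: simple_graph_def)
  let ?N = "{z. {x, z} \<in> E}"
  have N: "?N \<subseteq> V - {x}" using edgeD[OF G] by blast
  have "(\<Sum>a\<in>V. F a * lazy_measure E m1 m2 \<epsilon> x a)
      = F x * (1 - \<epsilon> * weighted_deg E m1 m2 x) + (\<Sum>a\<in>V - {x}. F a * lazy_measure E m1 m2 \<epsilon> x a)"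
    using fin x by (subst sum.remove) (auto simp: lazy_measure_def)
  also have "(\<Sum>a\<in>V - {x}. F a * lazy_measure E m1 m2 \<epsilon> x a) = (\<Sum>a\<in>?N. F a * (\<epsilon> * m2 {x, a} / m1 x))"
    using fin N by (intro sum.mono_neutral_cong_right) (auto simp: lazy_measure_def)
  also have "\<dots> = \<epsilon> / m1 x * (\<Sum>a\<in>?N. m2 {x, a} * F a)"
    by (simp add: sum_distrib_left mult_ac)
  finally show ?thesis
    by (simp add: weighted_deg_def right_diff_distrib sum_subtractf algebra_simps sum_distrib_left)
qed

text \<open>Forman curvature sums over incident edges, the lazy measure over neighbours; passing to
  the other endpoint of an edge identifies the two.\<close>

lemma incident_edges_sum:
  "(\<Sum>h | h \<in> E \<and> x \<in> h \<and> h \<noteq> {x, y}. g h) = (\<Sum>z | {x, z} \<in> E \<and> z \<noteq> y. g {x, z})"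
  if "simple_graph V E"
proof (rule sum.reindex_bij_betw[symmetric])
  show "bij_betw (\<lambda>z. {x, z}) {z. {x, z} \<in> E \<and> z \<noteq> y} {h. h \<in> E \<and> x \<in> h \<and> h \<noteq> {x, y}}"
  proof (rule bij_betw_imageI)
    show "inj_on (\<lambda>z. {x, z}) {z. {x, z} \<in> E \<and> z \<noteq> y}"
      by (auto simp: inj_on_def doubleton_eq_iff)
    have "h \<in> (\<lambda>z. {x, z}) ` {z. {x, z} \<in> E \<and> z \<noteq> y}" if h: "h \<in> E" "x \<in> h" "h \<noteq> {x, y}" for h
    proof -
      obtain u v where "h = {u, v}"
        using \<open>simple_graph V E\<close> h(1) by (auto simp: simple_graph_def)
      then obtain z where "h = {x, z}" using h(2) by (metis doubleton_eq_iff insertE singletonD)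
      then show ?thesis using h by auto
    qed
    then show "(\<lambda>z. {x, z}) ` {z. {x, z} \<in> E \<and> z \<noteq> y} = {h. h \<in> E \<and> x \<in> h \<and> h \<noteq> {x, y}}"
      by (fastforce simp: doubleton_eq_iff)
  qed
qed

lemma neighbours_sum_split:
  fixes g :: "'a \<Rightarrow> real"
  assumes "simple_graph V E" "{x, y} \<in> E"
  shows "(\<Sum>z | {x, z} \<in> E. g z) = g y + (\<Sum>z | {x, z} \<in> E \<and> z \<noteq> y. g z)"
proof -
  have "{z. {x, z} \<in> E \<and> z \<noteq> y} = {z. {x, z} \<in> E} - {y}" by auto
  then show ?thesis
    using assms finite_neighbours[OF assms(1), of x] by (simp add: sum.remove)
qed

section \<open>Cuts, potentials and curvature in trees\<close>

text \<open>\<open>S\<close> is the component of \<open>u\<close> after removal of the edge.\<close>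

lemma tree_cut:
  assumes tree: "tree V E" and uv: "{u, v} \<in> E"
  obtains S where "u \<in> S" "v \<notin> S"
    "\<And>a b. {a, b} \<in> E \<Longrightarrow> {a, b} \<noteq> {u, v} \<Longrightarrow> a \<in> S \<longleftrightarrow> b \<in> S"
proof -
  have G: "simple_graph V E" using tree by (simp add: tree_def connected_graph_def)
  define S where "S = {z. \<exists>p. walk_between V (E - {{u, v}}) u z p}"
  have "u \<in> S"
    using edgeD[OF G uv] by (auto simp: S_def walk_between_def walk_def intro!: exI[of _ "[u]"])
  moreover have "v \<notin> S"
  proof
    assume "v \<in> S"
    then obtain r where "walk_between V (E - {{u, v}}) u v r" by (auto simp: S_def)
    then obtain p where p: "walk_between V (E - {{u, v}}) u v p" "distinct p"
      by (rule distinct_walk_exists)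
    have walk: "walk V (E - {{u, v}}) p" "hd p = u" "last p = v" "p \<noteq> []"
      using p by (auto simp: walk_between_def walk_def)
    obtain q where q: "p = u # q" using walk by (cases p) auto
    have "q \<noteq> []" using walk q edgeD(3)[OF G uv] by auto
    \<comment> \<open>A walk with only two vertices would traverse the deleted edge; with at least
      three, adding that edge closes a cycle.\<close>
    moreover have "tl q \<noteq> []"
    proof
      assume "tl q = []"
      then have "q = [v]" using \<open>q \<noteq> []\<close> walk q by (cases q) auto
      then show False using walk q by (simp add: walk_def)
    qed
    ultimately have "3 \<le> length p" using q by (cases q; cases "tl q") auto
    moreover have "walk V E p"
      using walk by (auto simp: walk_def elim: successively_mono)
    ultimately have "cycle V E p"
      using p walk uv by (simp add: cycle_def insert_commute)
    then show False using tree by (simp add: tree_def)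
  qed
  moreover have "b \<in> S" if ab: "{a, b} \<in> E" "{a, b} \<noteq> {u, v}" and "a \<in> S" for a b
  proof -
    obtain p where "walk_between V (E - {{u, v}}) u a p" using \<open>a \<in> S\<close> by (auto simp: S_def)
    moreover from this have "p \<noteq> []" by (simp add: walk_between_def walk_def)
    ultimately have "walk_between V (E - {{u, v}}) u b (p @ [b])"
      using ab edgeD[OF G ab(1)] by (simp add: walk_between_def walk_snoc)
    then show ?thesis by (auto simp: S_def)
  qed
  ultimately show ?thesis
    using that[of S] by (metis insert_commute)
qed

locale weighted_tree = weighted_graph +
  assumes tree: "tree V E"
begin

text \<open>The edge itself is a walk, which bounds the distance from above. For the lower bound, a
  function jumping by \<open>w {u, v}\<close> across the cut of this edge and constant along all
  others is an admissible potential.\<close>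

lemma edge_dist:
  assumes uv: "{u, v} \<in> E"
  shows "d u v = w {u, v}"
proof (rule antisym)
  show "d u v \<le> w {u, v}"
    using dist_step[OF uv, of v] dist_refl edge[OF uv] by simp
  obtain S where S: "u \<in> S" "v \<notin> S"
    "\<And>a b. {a, b} \<in> E \<Longrightarrow> {a, b} \<noteq> {u, v} \<Longrightarrow> a \<in> S \<longleftrightarrow> b \<in> S"
    using tree_cut[OF tree uv] by blast
  define F where "F z = (if z \<in> S then w {u, v} else 0)" for z
  have "F a - F b \<le> w {a, b}" if "{a, b} \<in> E" for a b
    using S(3)[OF that] weight_pos[OF that] weight_pos[OF uv]
    by (cases "{a, b} = {u, v}") (auto simp: F_def)
  from lipschitz_le_dist[of F, OF this] show "w {u, v} \<le> d u v"
    using S edge[OF uv] by (force simp: F_def)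
qed

text \<open>The signed distance to \<open>y\<close>, negative on the side of \<open>y\<close>, is an optimal Kantorovich
  potential for transport from the neighbourhood of \<open>x\<close> to that of \<open>y\<close>.\<close>

lemma edge_potential:
  assumes xy: "{x, y} \<in> E"
  obtains F where
    "\<And>a b. a \<in> V \<Longrightarrow> b \<in> V \<Longrightarrow> F a - F b \<le> d a b"
    "F x = w {x, y}" "F y = 0"
    "\<And>a. {x, a} \<in> E \<Longrightarrow> a \<noteq> y \<Longrightarrow> F a = w {x, y} + w {x, a}"
    "\<And>b. {y, b} \<in> E \<Longrightarrow> b \<noteq> x \<Longrightarrow> F b = - w {y, b}"
proof -
  obtain S where S: "x \<in> S" "y \<notin> S"
    and cut: "\<And>a b. {a, b} \<in> E \<Longrightarrow> {a, b} \<noteq> {x, y} \<Longrightarrow> a \<in> S \<longleftrightarrow> b \<in> S"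
    using tree_cut[OF tree xy] by blast
  \<comment> \<open>On the side of \<open>x\<close> the distance to \<open>y\<close> is written as a
    detour through \<open>x\<close>. With this form every edge other than \<open>{x, y}\<close>
    stays on one side, where \<open>dist_step\<close> bounds the increment.\<close>
  define F where "F z = (if z \<in> S then w {x, y} + d z x else - d z y)" for z
  have V: "x \<in> V" "y \<in> V" "x \<noteq> y" using edge[OF xy] by auto
  have Fxy: "F x = w {x, y}" "F y = 0" using S dist_refl V by (auto simp: F_def)
  have "F a - F b \<le> w {a, b}" if ab: "{a, b} \<in> E" for a b
  proof (cases "{a, b} = {x, y}")
    case True
    then show ?thesis using Fxy weight_pos[OF xy] by (auto simp: doubleton_eq_iff insert_commute)
  next
    case False
    have "d a x \<le> w {a, b} + d b x" "d b y \<le> w {a, b} + d a y"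
      using dist_step[of a b x] dist_step[of b a y] ab V by (simp_all add: insert_commute)
    then show ?thesis using cut[OF ab False] by (simp add: F_def)
  qed
  from lipschitz_le_dist[of F, OF this]
  have "\<And>a b. a \<in> V \<Longrightarrow> b \<in> V \<Longrightarrow> F a - F b \<le> d a b" by blast
  moreover have "F a = w {x, y} + w {x, a}" if "{x, a} \<in> E" "a \<noteq> y" for a
    using that cut[of x a] S edge_dist[of a x] by (auto simp: F_def doubleton_eq_iff insert_commute)
  moreover have "F b = - w {y, b}" if "{y, b} \<in> E" "b \<noteq> x" for b
    using that cut[of y b] S edge_dist[of b y] by (auto simp: F_def doubleton_eq_iff insert_commute)
  ultimately show ?thesis using that Fxy by blast
qed

text \<open>After the mass common to both measures at \<open>x\<close> and \<open>y\<close> is kept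
  in place, all remaining transport crosses the edge \<open>{x, y}\<close>, so the potential of
  \<open>edge_potential\<close> is tight on it. The bound on \<epsilon> lets each endpoint hold its
  share and leaves a positive mass to be moved.\<close>

lemma wasserstein_lazy_measures:
  assumes xy: "{x, y} \<in> E" and m1: "\<And>x. x \<in> V \<Longrightarrow> 0 < m1 x" and m2: "\<And>h. h \<in> E \<Longrightarrow> 0 < m2 h"
    and \<epsilon>: "0 < \<epsilon>"
    and small: "\<epsilon> * (weighted_deg E m1 m2 x + weighted_deg E m1 m2 y
        + m2 {x, y} / m1 x + m2 {x, y} / m1 y) < 1"
  shows "wasserstein V d (lazy_measure E m1 m2 \<epsilon> x) (lazy_measure E m1 m2 \<epsilon> y)
    = w {x, y} * (1 - \<epsilon> * forman_curvature E m1 m2 w x y)"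
proof -
  let ?\<mu> = "lazy_measure E m1 m2 \<epsilon> x" and ?\<nu> = "lazy_measure E m1 m2 \<epsilon> y"
  have yx: "{y, x} \<in> E" "{y, x} = {x, y}" using xy by (simp_all add: insert_commute)
  have V: "x \<in> V" "y \<in> V" "x \<noteq> y" using edge[OF xy] by auto
  have fin: "finite V" using simple by (simp add: simple_graph_def)
  obtain F where lip: "\<And>a b. a \<in> V \<Longrightarrow> b \<in> V \<Longrightarrow> F a - F b \<le> d a b"
    and F: "F x = w {x, y}" "F y = 0"
      "\<And>a. {x, a} \<in> E \<Longrightarrow> a \<noteq> y \<Longrightarrow> F a = w {x, y} + w {x, a}"
      "\<And>b. {y, b} \<in> E \<Longrightarrow> b \<noteq> x \<Longrightarrow> F b = - w {y, b}"
    using edge_potential[OF xy] by blast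
  define \<alpha> \<beta> where "\<alpha> = \<epsilon> * m2 {x, y} / m1 x" and "\<beta> = \<epsilon> * m2 {x, y} / m1 y"
  have \<alpha>\<beta>: "0 \<le> \<alpha>" "0 \<le> \<beta>"
    using m1[OF V(1)] m1[OF V(2)] m2[OF xy] \<epsilon> by (simp_all add: \<alpha>_def \<beta>_def)
  have deg: "0 \<le> \<epsilon> * weighted_deg E m1 m2 z" if "z \<in> V" for z
    using m1[OF that] m2 \<epsilon> unfolding weighted_deg_def
    by (intro mult_nonneg_nonneg sum_nonneg) (auto simp: less_imp_le)
  have small': "\<epsilon> * weighted_deg E m1 m2 x + \<epsilon> * weighted_deg E m1 m2 y + \<alpha> + \<beta> < 1"
    using small by (simp add: \<alpha>_def \<beta>_def algebra_simps)
  \<comment> \<open>The second measure gives \<open>x\<close> mass \<beta> and the first gives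
    \<open>y\<close> mass \<alpha>. Keeping exactly these amounts leaves nothing of the first
    measure at \<open>y\<close> and nothing of the second at \<open>x\<close>.\<close>
  define \<delta> where "\<delta> a = (if a = x then \<beta> else if a = y then \<alpha> else 0)" for a
  define \<pi> where "\<pi> a b = (if a = b then \<delta> a else 0) + (?\<mu> a - \<delta> a) * (?\<nu> b - \<delta> b) / (1 - sum \<delta> V)"
    for a b
  have nonneg: "0 \<le> \<epsilon> * m2 {z, a} / m1 z" if "{z, a} \<in> E" for z a
    using m1[of z] m2[OF that] edge[OF that] \<epsilon> by simp
  have "sum \<delta> V = \<alpha> + \<beta>"
  proof -
    have "sum \<delta> V = sum \<delta> {x, y}"
      using fin V by (intro sum.mono_neutral_right) (auto simp: \<delta>_def)
    then show ?thesis using V by (simp add: \<delta>_def)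
  qed
  moreover have "sum ?\<mu> V = 1" "sum ?\<nu> V = 1"
    using lazy_measure_sum[OF simple V(1), of "\<lambda>_. 1"] lazy_measure_sum[OF simple V(2), of "\<lambda>_. 1"]
    by simp_all
  moreover have "\<delta> a \<le> ?\<mu> a" "\<delta> a \<le> ?\<nu> a" "0 \<le> \<delta> a" if "a \<in> V" for a
    using V xy yx small' deg[OF V(1)] deg[OF V(2)] \<alpha>\<beta> nonneg[of x a] nonneg[of y a]
    by (auto simp: \<delta>_def lazy_measure_def) (auto simp: \<alpha>_def \<beta>_def)
  ultimately have "\<pi> \<in> couplings V ?\<mu> ?\<nu>"
    unfolding \<pi>_def using small' deg[OF V(1)] deg[OF V(2)] by (intro residual_coupling fin) auto
  \<comment> \<open>Mass that moves goes from \<open>a\<close> via \<open>x\<close> and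
    \<open>y\<close> to \<open>b\<close>, with trivial steps if \<open>a = x\<close> or
    \<open>b = y\<close>; along this route \<open>F\<close> drops by exactly the length.\<close>
  moreover have "d a b \<le> F a - F b" if "a \<in> V" "b \<in> V" "\<pi> a b \<noteq> 0" for a b
  proof (cases "a = b")
    case True
    then show ?thesis using dist_refl that by simp
  next
    case False
    then have ne: "?\<mu> a - \<delta> a \<noteq> 0" "?\<nu> b - \<delta> b \<noteq> 0" using that by (auto simp: \<pi>_def)
    have a: "a = x \<or> {x, a} \<in> E \<and> a \<noteq> y"
      using ne(1) V xy by (auto simp: lazy_measure_def \<delta>_def \<alpha>_def split: if_splits)
    have b: "b = y \<or> {y, b} \<in> E \<and> b \<noteq> x"
      using ne(2) V yx by (auto simp: lazy_measure_def \<delta>_def \<beta>_def split: if_splits)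
    have "d a b \<le> F a - w {x, y} + d x b"
      using a F dist_step[of a x b] that by (auto simp: insert_commute)
    also have "d x b \<le> w {x, y} + d y b" by (rule dist_step[OF xy that(2)])
    also have "d y b = - F b"
      using b F edge_dist[of y b] dist_refl V by auto
    finally show ?thesis by simp
  qed
  ultimately have "wasserstein V d ?\<mu> ?\<nu> = (\<Sum>a\<in>V. F a * ?\<mu> a) - (\<Sum>b\<in>V. F b * ?\<nu> b)"
    using lip by (intro wasserstein_eqI) auto
  also have "(\<Sum>a\<in>V. F a * ?\<mu> a)
      = w {x, y} + \<epsilon> / m1 x * (- m2 {x, y} * w {x, y} + (\<Sum>z | {x, z} \<in> E \<and> z \<noteq> y. m2 {x, z} * w {x, z}))"
    using F by (simp add: lazy_measure_sum[OF simple V(1)] neighbours_sum_split[OF simple xy])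
  also have "(\<Sum>b\<in>V. F b * ?\<nu> b)
      = \<epsilon> / m1 y * (m2 {x, y} * w {x, y} - (\<Sum>z | {y, z} \<in> E \<and> z \<noteq> x. m2 {y, z} * w {y, z}))"
    using F by (simp add: lazy_measure_sum[OF simple V(2)] neighbours_sum_split[OF simple yx(1)] yx(2) sum_negf)
  finally have W: "wasserstein V d ?\<mu> ?\<nu> = w {x, y}
      + \<epsilon> / m1 x * (- m2 {x, y} * w {x, y} + (\<Sum>z | {x, z} \<in> E \<and> z \<noteq> y. m2 {x, z} * w {x, z}))
      - \<epsilon> / m1 y * (m2 {x, y} * w {x, y} - (\<Sum>z | {y, z} \<in> E \<and> z \<noteq> x. m2 {y, z} * w {y, z}))" .
  have K: "forman_curvature E m1 m2 w x y = m2 {x, y} / m1 x + m2 {x, y} / m1 y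
      - (\<Sum>z | {x, z} \<in> E \<and> z \<noteq> y. m2 {x, z} * w {x, z}) / (m1 x * w {x, y})
      - (\<Sum>z | {y, z} \<in> E \<and> z \<noteq> x. m2 {y, z} * w {y, z}) / (m1 y * w {x, y})"
    unfolding forman_curvature_def incident_edges_sum[OF simple, where x = x and y = y]
      incident_edges_sum[OF simple, where x = y and y = x, unfolded yx(2)]
    by (simp add: sum_divide_distrib)
  show ?thesis
    unfolding W K using weight_pos[OF xy] m1[OF V(1)] m1[OF V(2)]
    by (simp add: field_simps)
qed

text \<open>The difference quotient is not merely convergent: for every small positive \<epsilon> it
  already equals the Forman curvature.\<close>

lemma lly_eq_forman:
  assumes xy: "{x, y} \<in> E" and m1: "\<And>x. x \<in> V \<Longrightarrow> 0 < m1 x" and m2: "\<And>h. h \<in> E \<Longrightarrow> 0 < m2 h"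
  shows "lly_curvature V E m1 m2 w x y = forman_curvature E m1 m2 w x y"
proof -
  define C where "C = weighted_deg E m1 m2 x + weighted_deg E m1 m2 y
    + m2 {x, y} / m1 x + m2 {x, y} / m1 y"
  have "((\<lambda>\<epsilon>. \<epsilon> * C) \<longlongrightarrow> 0 * C) (at_right 0)" by (intro tendsto_intros)
  then have "\<forall>\<^sub>F \<epsilon> in at_right 0. \<epsilon> * C < 1" by (rule order_tendstoD) simp
  then have "\<forall>\<^sub>F \<epsilon> in at_right 0. forman_curvature E m1 m2 w x y = 1 / \<epsilon> *
       (1 - wasserstein V d (lazy_measure E m1 m2 \<epsilon> x) (lazy_measure E m1 m2 \<epsilon> y) / d x y)"
    using eventually_at_right_less[of 0]
  proof eventually_elim
    case (elim \<epsilon>)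
    then show ?case
      using wasserstein_lazy_measures[OF xy m1 m2 elim(2)] weight_pos[OF xy]
      by (simp add: edge_dist[OF xy] C_def)
  qed
  then have "((\<lambda>\<epsilon>. 1 / \<epsilon> * (1 - wasserstein V d (lazy_measure E m1 m2 \<epsilon> x)
      (lazy_measure E m1 m2 \<epsilon> y) / d x y)) \<longlongrightarrow> forman_curvature E m1 m2 w x y) (at_right 0)"
    by (rule Lim_transform_eventually[OF tendsto_const])
  then show ?thesis
    unfolding lly_curvature_def by (intro tendsto_Lim) auto
qed

end

section \<open>The flow as a linear system\<close>

text \<open>At the first time at which some component vanishes, that component \<open>f i\<close> would still be at
  least \<open>exp (- c i t) * f i 0\<close>.\<close>

lemma positive_invariant:
  fixes f :: "'i \<Rightarrow> real \<Rightarrow> real"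
  assumes fin: "finite I"
    and init: "\<And>i. i \<in> I \<Longrightarrow> 0 < f i 0"
    and cont: "\<And>i. i \<in> I \<Longrightarrow> continuous_on {0..} (f i)"
    and deriv: "\<And>i t. i \<in> I \<Longrightarrow> 0 < t \<Longrightarrow> \<forall>j\<in>I. 0 < f j t \<Longrightarrow>
      \<exists>D. (f i has_real_derivative D) (at t) \<and> - c i * f i t \<le> D"
    and "i \<in> I" "0 \<le> t"
  shows "0 < f i t"
proof (rule ccontr)
  assume neg: "\<not> 0 < f i t"
  \<comment> \<open>\<open>Z\<close> collects the times up to \<open>t\<close> at which some
    component is not positive. It is closed, so its infimum \<open>s\<close> belongs to it, while
    all components are positive before \<open>s\<close>.\<close>
  define Z where "Z = (\<Union>j\<in>I. {s \<in> {0..t}. f j s \<le> 0})"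
  have "closed {s \<in> {0..t}. f j s \<le> 0}" if "j \<in> I" for j
    using continuous_on_subset[OF cont[OF that], of "{0..t}"]
    by (intro continuous_closed_preimage_constant[of "{0..t}", simplified]
        continuous_on_closed_Collect_le[of "{0..t}"] continuous_intros) auto
  then have "closed Z" using fin by (auto simp: Z_def)
  moreover have "t \<in> Z" using neg \<open>i \<in> I\<close> \<open>0 \<le> t\<close> unfolding Z_def by force
  then have "Z \<noteq> {}" by blast
  moreover have below: "bdd_below Z" by (auto simp: Z_def intro: bdd_belowI)
  ultimately have "Inf Z \<in> Z" by (intro closed_contains_Inf)
  moreover define s where "s = Inf Z"
  ultimately obtain j where j: "j \<in> I" "f j s \<le> 0" and s: "0 \<le> s" "s \<le> t"
    by (auto simp: Z_def)
  have pos: "0 < f k r" if "k \<in> I" "0 \<le> r" "r < s" for k r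
  proof (rule ccontr)
    assume "\<not> 0 < f k r"
    then have "r \<in> Z" using that s unfolding Z_def by force
    then show False using cInf_lower[OF _ below, of r] that by (simp add: s_def)
  qed
  \<comment> \<open>The integrating factor turns the differential inequality into monotonicity of
    \<open>g\<close> up to time \<open>s\<close>, contradicting
    \<open>f j s \<le> 0\<close>.\<close>
  define g where "g r = exp (c j * r) * f j r" for r
  have "g 0 \<le> g s"
  proof (rule DERIV_nonneg_imp_increasing_open[OF s(1)])
    show "continuous_on {0..s} g"
      unfolding g_def by (intro continuous_intros continuous_on_subset[OF cont[OF j(1)]]) auto
    fix r assume r: "0 < r" "r < s"
    then obtain D where D: "(f j has_real_derivative D) (at r)" "- c j * f j r \<le> D"
      using deriv[OF j(1), of r] pos by auto
    have "((\<lambda>r. exp (c j * r)) has_real_derivative exp (c j * r) * c j) (at r)"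
      by (auto intro!: derivative_eq_intros)
    from DERIV_mult[OF this D(1)]
    have "(g has_real_derivative exp (c j * r) * (c j * f j r + D)) (at r)"
      unfolding g_def by (simp add: algebra_simps)
    moreover have "0 \<le> exp (c j * r) * (c j * f j r + D)" using D(2) by simp
    ultimately show "\<exists>D. (g has_real_derivative D) (at r) \<and> 0 \<le> D" by blast
  qed
  moreover have "0 < g 0" using init[OF j(1)] by (simp add: g_def)
  moreover have "g s \<le> 0" using j(2) by (simp add: g_def mult_le_0_iff)
  ultimately show False by simp
qed

text \<open>Multiplication by the weight cancels the quotients of weights, leaving an expression
  linear in \<open>w\<close>; this is where the flow becomes a linear system.\<close>

lemma forman_curvature_times_weight:
  assumes "u \<noteq> v" "w {u, v} \<noteq> 0"
  shows "forman_curvature E m1 m2 w u v * w {u, v}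
    = (\<Sum>x\<in>{u, v}. m2 {u, v} / m1 x) * w {u, v}
      - (\<Sum>x\<in>{u, v}. \<Sum>h | h \<in> E \<and> x \<in> h \<and> h \<noteq> {u, v}. m2 h / m1 x * w h)"
proof -
  have "(\<Sum>h\<in>H. m2 h / m1 x * (w h / w {u, v})) * w {u, v} = (\<Sum>h\<in>H. m2 h / m1 x * w h)" for H x
    using assms(2) by (simp add: sum_distrib_right)
  then show ?thesis
    using assms(1) by (simp add: forman_curvature_def left_diff_distrib)
qed

section \<open>The Forman matrix of a connected graph\<close>

text \<open>Edges are indexed by a finite type so that they can index matrices. Types are nonempty,
  so the bijection also encodes that there is at least one edge.\<close>

locale forman_graph =
  fixes V :: "'a set" and E :: "'a set set" and m1 :: "'a \<Rightarrow> real" and m2 :: "'a set \<Rightarrow> real"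
    and e :: "'n::finite \<Rightarrow> 'a set"
  assumes connected: "connected_graph V E" and enum: "bij_betw e UNIV E"
    and m1_pos: "\<And>x. x \<in> V \<Longrightarrow> 0 < m1 x" and m2_pos: "\<And>h. h \<in> E \<Longrightarrow> 0 < m2 h"
begin

abbreviation "A \<equiv> forman_matrix m1 m2 e"

lemma simple: "simple_graph V E"
  using connected by (simp add: connected_graph_def)

lemma e_in [simp]: "e l \<in> E"
  using enum by (auto simp: bij_betw_def)

lemma e_eq_iff [simp]: "e i = e j \<longleftrightarrow> i = j"
  using enum by (auto simp: bij_betw_def inj_eq)

lemma e_surj: "h \<in> E \<Longrightarrow> \<exists>l. h = e l"
  using enum by (auto simp: bij_betw_def)

lemma endpoints: "\<exists>u v. e l = {u, v} \<and> u \<noteq> v \<and> u \<in> V \<and> v \<in> V"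
proof -
  have "\<exists>u\<in>V. \<exists>v\<in>V. u \<noteq> v \<and> e l = {u, v}"
    using simple by (simp add: simple_graph_def)
  then show ?thesis by auto
qed

lemma e_subset: "x \<in> e l \<Longrightarrow> x \<in> V"
  using endpoints[of l] by auto

lemma finite_e [simp]: "finite (e l)"
  using endpoints[of l] by auto

text \<open>Consecutive edges of a walk share a vertex, so membership in \<open>S\<close> spreads
  along it. Connectedness of the graph thereby becomes irreducibility of the matrix.\<close>

lemma incident_edge_mem:
  assumes S: "\<And>i j. i \<in> S \<Longrightarrow> e i \<inter> e j \<noteq> {} \<Longrightarrow> j \<in> S"
    and "i \<in> S" and "walk V E q" "hd q \<in> e i" "last q \<in> e j"
  shows "j \<in> S"
  using assms(3-)
proof (induction q arbitrary: j rule: rev_induct)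
  case (snoc x q)
  show ?case
  proof (cases "q = []")
    case True
    then show ?thesis using snoc.prems S[OF \<open>i \<in> S\<close>, of j] by auto
  next
    case False
    then have "{last q, x} \<in> E" "walk V E q" "hd q \<in> e i"
      using snoc.prems by (simp_all add: walk_snoc)
    moreover from this obtain k where k: "{last q, x} = e k" using e_surj by blast
    ultimately have "k \<in> S" using snoc.IH by blast
    then show ?thesis using S[of k j] k snoc.prems by auto
  qed
qed (simp add: walk_def)

sublocale irreducible_symmetric_metzler A
proof
  show "transpose A = A"
    by (auto simp: transpose_def forman_matrix_def vec_eq_iff Int_commute mult.commute)
  have term_pos: "0 < sqrt (m2 (e i) * m2 (e j)) / m1 x" if "x \<in> e i" for i j x
    using m1_pos[OF e_subset[OF that]] m2_pos by simp
  show "0 \<le> A $ i $ j" if "i \<noteq> j" for i j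
    using that term_pos[THEN less_imp_le] by (auto simp: forman_matrix_def intro!: sum_nonneg)
  show "S = UNIV" if "S \<noteq> {}" and zero: "\<And>i j. i \<in> S \<Longrightarrow> j \<notin> S \<Longrightarrow> A $ i $ j = 0" for S
  proof -
    have step: "j \<in> S" if "i \<in> S" "e i \<inter> e j \<noteq> {}" for i j
    proof (rule ccontr)
      assume "j \<notin> S"
      then have "i \<noteq> j" using that by auto
      then have "0 < A $ i $ j"
        using that term_pos by (auto simp: forman_matrix_def intro!: sum_pos)
      then show False using zero[OF \<open>i \<in> S\<close> \<open>j \<notin> S\<close>] by simp
    qed
    obtain i where i: "i \<in> S" using \<open>S \<noteq> {}\<close> by blast
    have "j \<in> S" for j
    proof -
      obtain u a where ua: "u \<in> e i" "a \<in> e j" using endpoints[of i] endpoints[of j] by blast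
      then have "u \<in> V" "a \<in> V" using e_subset by auto
      then obtain q where "walk_between V E u a q"
        using connected by (auto simp: connected_graph_def)
      then show ?thesis
        using incident_edge_mem[of S i q j] step i ua by (auto simp: walk_between_def)
    qed
    then show ?thesis by blast
  qed
qed

text \<open>The factor \<open>sqrt (m2 (e j))\<close> symmetrizes the system: together with the one
  in the matrix entry it makes \<open>m2 (e j)\<close>, and \<open>sqrt (m2 (e l))\<close> comes out
  of the row.\<close>

lemma forman_matrix_vector:
  assumes uv: "e l = {u, v}" and w: "0 < w {u, v}"
  shows "(A *v (\<chi> j. sqrt (m2 (e j)) * w (e j))) $ l
    = - sqrt (m2 (e l)) * (forman_curvature E m1 m2 w u v * w (e l))"
proof -
  have "u \<noteq> v" using edgeD(3)[OF simple, of u v] e_in[of l] uv by simp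
  \<comment> \<open>Written over all endpoints with a condition, the sum has a range independent of
    \<open>j\<close> and can be interchanged with the sum over \<open>j\<close>.\<close>
  have entry: "A $ l $ j * (sqrt (m2 (e j)) * w (e j))
      = (\<Sum>x\<in>e l. if x \<in> e j then sqrt (m2 (e l)) * (m2 (e j) / m1 x * w (e j)) else 0)"
    if "j \<noteq> l" for j
  proof -
    have "A $ l $ j * (sqrt (m2 (e j)) * w (e j))
        = (\<Sum>x\<in>e l \<inter> e j. sqrt (m2 (e l) * m2 (e j)) / m1 x * (sqrt (m2 (e j)) * w (e j)))"
      using that by (simp add: forman_matrix_def sum_distrib_right)
    also have "\<dots> = (\<Sum>x\<in>e l \<inter> e j. sqrt (m2 (e l)) * (m2 (e j) / m1 x * w (e j)))"
    proof (intro sum.cong refl)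
      fix x
      have "sqrt (m2 (e j)) * sqrt (m2 (e j)) = m2 (e j)"
        using m2_pos[OF e_in[of j]] by simp
      then show "sqrt (m2 (e l) * m2 (e j)) / m1 x * (sqrt (m2 (e j)) * w (e j))
          = sqrt (m2 (e l)) * (m2 (e j) / m1 x * w (e j))"
        by (simp add: real_sqrt_mult mult_ac)
    qed
    finally show ?thesis by (simp only: sum.inter_restrict finite_e)
  qed
  have reindex: "(\<Sum>j\<in>UNIV - {l}. if x \<in> e j then g (e j) else 0)
      = (\<Sum>h | h \<in> E \<and> x \<in> h \<and> h \<noteq> {u, v}. g h)" for x and g :: "'a set \<Rightarrow> real"
  proof -
    have "bij_betw e {j. j \<noteq> l \<and> x \<in> e j} {h. h \<in> E \<and> x \<in> h \<and> h \<noteq> {u, v}}"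
      unfolding uv[symmetric] using e_surj by (auto simp: bij_betw_def inj_on_def)
    then have "(\<Sum>j | j \<noteq> l \<and> x \<in> e j. g (e j)) = (\<Sum>h | h \<in> E \<and> x \<in> h \<and> h \<noteq> {u, v}. g h)"
      by (rule sum.reindex_bij_betw)
    then show ?thesis
      by (simp flip: sum.inter_filter)
  qed
  have "(A *v (\<chi> j. sqrt (m2 (e j)) * w (e j))) $ l
      = A $ l $ l * (sqrt (m2 (e l)) * w (e l))
        + (\<Sum>j\<in>UNIV - {l}. A $ l $ j * (sqrt (m2 (e j)) * w (e j)))"
    by (simp add: matrix_vector_mult_def sum.remove[of UNIV l])
  also have "(\<Sum>j\<in>UNIV - {l}. A $ l $ j * (sqrt (m2 (e j)) * w (e j)))
      = (\<Sum>x\<in>e l. \<Sum>j\<in>UNIV - {l}. if x \<in> e j then sqrt (m2 (e l)) * (m2 (e j) / m1 x * w (e j)) else 0)"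
    by (subst sum.swap) (intro sum.cong refl, simp add: entry)
  also have "\<dots> = sqrt (m2 (e l)) *
      (\<Sum>x\<in>{u, v}. \<Sum>h | h \<in> E \<and> x \<in> h \<and> h \<noteq> {u, v}. m2 h / m1 x * w h)"
    unfolding sum_distrib_left uv
  proof (intro sum.cong refl)
    fix x
    show "(\<Sum>j\<in>UNIV - {l}. if x \<in> e j then sqrt (m2 {u, v}) * (m2 (e j) / m1 x * w (e j)) else 0)
      = (\<Sum>h | h \<in> E \<and> x \<in> h \<and> h \<noteq> {u, v}. sqrt (m2 {u, v}) * (m2 h / m1 x * w h))"
      by (rule reindex)
  qed
  also have "A $ l $ l = - (\<Sum>x\<in>{u, v}. m2 {u, v} / m1 x)"
    by (simp add: uv forman_matrix_def)
  finally show ?thesis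
    unfolding uv forman_curvature_times_weight[of u v w, OF \<open>u \<noteq> v\<close> less_imp_neq[OF w, symmetric]]
    by (simp only: right_diff_distrib minus_mult_left mult_ac)
qed

end

section \<open>Limits of the weights and of the curvature\<close>

text \<open>\<open>K\<close> need agree with the Forman curvature only on positive weights, which is
  what a tree provides for the Lin-Lu-Yau curvature; both flows are thus treated together.\<close>

locale forman_flow = forman_graph V E m1 m2 e
  for V :: "'a set" and E m1 m2 and e :: "'n::finite \<Rightarrow> 'a set" +
  fixes K :: "('a set \<Rightarrow> real) \<Rightarrow> 'a \<Rightarrow> 'a \<Rightarrow> real"
    and \<omega>\<^sub>0 :: "'a set \<Rightarrow> real" and \<omega> :: "real \<Rightarrow> 'a set \<Rightarrow> real"
  assumes init_pos: "\<And>h. h \<in> E \<Longrightarrow> 0 < \<omega>\<^sub>0 h"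
    and K_eq: "\<And>w u v. (\<And>h. h \<in> E \<Longrightarrow> 0 < w h) \<Longrightarrow> {u, v} \<in> E \<Longrightarrow>
      K w u v = forman_curvature E m1 m2 w u v"
    and flow: "ricci_flow E K \<omega>\<^sub>0 \<omega>"
begin

lemma init: "h \<in> E \<Longrightarrow> \<omega> 0 h = \<omega>\<^sub>0 h"
  and cont: "h \<in> E \<Longrightarrow> continuous_on {0..} (\<lambda>t. \<omega> t h)"
  and ode: "{u, v} \<in> E \<Longrightarrow> 0 < t \<Longrightarrow>
    ((\<lambda>s. \<omega> s {u, v}) has_real_derivative - K (\<omega> t) u v * \<omega> t {u, v}) (at t)"
  using flow by (auto simp: ricci_flow_def)

text \<open>The edges adjacent to \<open>h\<close> contribute nonnegatively to the derivative while
  all weights are positive, so only the diagonal rate \<open>c h\<close> can make the weight decay.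
  Positivity keeps \<open>K_eq\<close> applicable at all times.\<close>

lemma pos: "h \<in> E \<Longrightarrow> 0 \<le> t \<Longrightarrow> 0 < \<omega> t h"
proof (rule positive_invariant[where I = E and f = "\<lambda>h t. \<omega> t h" and c = "\<lambda>h. \<Sum>x\<in>h. m2 h / m1 x"])
  show "finite E" by (rule finite_edges[OF simple])
  fix h and t :: real assume h: "h \<in> E" and t: "0 < t" and p: "\<forall>j\<in>E. 0 < \<omega> t j"
  obtain u v where uv: "h = {u, v}" using endpoints e_surj[OF h] by metis
  note V = edgeD[OF simple h[unfolded uv]]
  have "0 \<le> (\<Sum>x\<in>{u, v}. \<Sum>h' | h' \<in> E \<and> x \<in> h' \<and> h' \<noteq> {u, v}. m2 h' / m1 x * \<omega> t h')"
    using V m1_pos m2_pos p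
    by (intro sum_nonneg mult_nonneg_nonneg divide_nonneg_nonneg) (auto simp: less_imp_le)
  moreover have "K (\<omega> t) u v = forman_curvature E m1 m2 (\<omega> t) u v"
    using p h uv by (intro K_eq) auto
  moreover have nz: "\<omega> t {u, v} \<noteq> 0" using p h uv by force
  ultimately have "- (\<Sum>x\<in>h. m2 h / m1 x) * \<omega> t h \<le> - K (\<omega> t) u v * \<omega> t {u, v}"
    using forman_curvature_times_weight[of u v "\<omega> t" E m1 m2, OF V(3) nz]
    unfolding uv mult_minus_left by simp
  moreover have "((\<lambda>t. \<omega> t h) has_real_derivative - K (\<omega> t) u v * \<omega> t {u, v}) (at t)"
    using ode[of u v t] h t unfolding uv by blast
  ultimately show "\<exists>D. ((\<lambda>t. \<omega> t h) has_real_derivative D) (at t) \<and> - (\<Sum>x\<in>h. m2 h / m1 x) * \<omega> t h \<le> D"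
    by blast
qed (use init init_pos cont in auto)

definition "y t = (\<chi> l. sqrt (m2 (e l)) * \<omega> t (e l))"

lemma matrix_y:
  assumes "e l = {u, v}" "0 \<le> t"
  shows "(A *v y t) $ l = - sqrt (m2 (e l)) * (K (\<omega> t) u v * \<omega> t (e l))"
  using forman_matrix_vector[OF assms(1), of "\<omega> t"] K_eq[of "\<omega> t" u v] pos[of _ t] assms e_in[of l]
  by (simp add: y_def)

lemma y_ode:
  assumes t: "0 < t"
  shows "(y has_vector_derivative A *v y t) (at t)"
proof -
  have "((\<lambda>t. y t $ l) has_real_derivative (A *v y t) $ l) (at t)" for l
  proof -
    obtain u v where uv: "e l = {u, v}" using endpoints by blast
    have "((\<lambda>t. sqrt (m2 (e l)) * \<omega> t {u, v}) has_real_derivative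
        sqrt (m2 (e l)) * (- K (\<omega> t) u v * \<omega> t {u, v})) (at t)"
      using ode[of u v t] e_in[of l] uv t by (intro DERIV_cmult) simp
    then show ?thesis using matrix_y[OF uv, of t] t by (simp add: y_def uv)
  qed
  then show ?thesis
    unfolding has_vector_derivative_def has_derivative_componentwise_within[of y]
    by (auto simp: Basis_vec_def inner_axis has_field_derivative_def mult.commute[of _ "_ $ _"] simp flip: scaleR_conv_of_real)
qed

lemma y_cont: "continuous_on {0..} y"
  unfolding y_def by (intro continuous_on_vec_lambda continuous_intros cont) simp

lemma rescaled_limit: "((\<lambda>t. exp (- \<Lambda> * t) *\<^sub>R y t) \<longlongrightarrow> (p \<bullet> y 0) *\<^sub>R p) at_top"
  by (rule linear_flow_limit[OF y_cont y_ode])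

text \<open>Both vectors have positive entries. The limit of the rescaled flow is therefore nonzero
  in every coordinate, which permits the divisions below.\<close>

lemma scale_pos: "0 < p \<bullet> y 0"
  unfolding inner_vec_def
  using perron_vector(3) m2_pos init init_pos by (intro sum_pos) (auto simp: y_def)

text \<open>The sum in the coefficient is the projection of the initial vector onto the Perron
  vector; the division by \<open>sqrt (m2 (e l))\<close> undoes the change of variables.\<close>

lemma limit_coeff_eq: "limit_coeff m1 m2 e \<omega>\<^sub>0 l = (p \<bullet> y 0) * p $ l / sqrt (m2 (e l))"
  by (simp add: limit_coeff_def Let_def inner_vec_def y_def init mult_ac)

lemma limit_coeff_pos: "0 < limit_coeff m1 m2 e \<omega>\<^sub>0 l"
  using scale_pos perron_vector(3) m2_pos by (simp add: limit_coeff_eq)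

lemma rescaled_weight_limit:
  "((\<lambda>t. exp (- \<Lambda> * t) * \<omega> t (e l)) \<longlongrightarrow> limit_coeff m1 m2 e \<omega>\<^sub>0 l) at_top"
proof -
  have nz: "sqrt (m2 (e l)) \<noteq> 0" using m2_pos[OF e_in[of l]] by simp
  from tendsto_divide[OF tendsto_vec_nth[OF rescaled_limit] tendsto_const nz, of l]
  show ?thesis using nz by (simp add: limit_coeff_eq y_def)
qed

text \<open>The common factor \<open>exp (- \<Lambda> * t)\<close> cancels in the quotient, so the
  limits of the rescaled weights suffice.\<close>

lemma normalized_weight_limit:
  "((\<lambda>t. \<omega> t (e l) / (\<Sum>h\<in>E. \<omega> t h)) \<longlongrightarrow>
    limit_coeff m1 m2 e \<omega>\<^sub>0 l / (\<Sum>h\<in>UNIV. limit_coeff m1 m2 e \<omega>\<^sub>0 h)) at_top"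
proof -
  have "(\<Sum>h\<in>UNIV. limit_coeff m1 m2 e \<omega>\<^sub>0 h) > 0"
    using limit_coeff_pos by (intro sum_pos) auto
  then have "((\<lambda>t. (exp (- \<Lambda> * t) * \<omega> t (e l)) / (\<Sum>h\<in>UNIV. exp (- \<Lambda> * t) * \<omega> t (e h))) \<longlongrightarrow>
      limit_coeff m1 m2 e \<omega>\<^sub>0 l / (\<Sum>h\<in>UNIV. limit_coeff m1 m2 e \<omega>\<^sub>0 h)) at_top"
    by (intro tendsto_divide tendsto_sum rescaled_weight_limit) auto
  moreover have "(\<Sum>h\<in>UNIV. \<omega> t (e h)) = (\<Sum>h\<in>E. \<omega> t h)" for t
    by (rule sum.reindex_bij_betw[OF enum])
  ultimately show ?thesis by (simp flip: sum_distrib_left)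
qed

text \<open>By \<open>matrix_y\<close>, the curvature of edge \<open>l\<close> is minus the quotient
  of the \<open>l\<close>-th entries of \<open>A *v y t\<close> and \<open>y t\<close>. This is
  invariant under scaling, so \<open>y\<close> may be replaced by the convergent \<open>z\<close>,
  whose limit is an eigenvector for \<Lambda>.\<close>

lemma curvature_limit:
  assumes uv: "{u, v} \<in> E"
  shows "((\<lambda>t. K (\<omega> t) u v) \<longlongrightarrow> - \<Lambda>) at_top"
proof -
  obtain l where l: "e l = {u, v}" using e_surj[OF uv] by metis
  define z where "z t = exp (- \<Lambda> * t) *\<^sub>R y t" for t
  define s where "s = p \<bullet> y 0"
  have z: "(z \<longlongrightarrow> s *\<^sub>R p) at_top" unfolding z_def s_def by (rule rescaled_limit)
  have nz: "(s *\<^sub>R p) $ l \<noteq> 0" using scale_pos perron_vector(3)[of l] by (simp add: s_def)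
  have "((\<lambda>t. - ((A *v z t) $ l / z t $ l)) \<longlongrightarrow> - ((A *v (s *\<^sub>R p)) $ l / (s *\<^sub>R p) $ l)) at_top"
    by (intro tendsto_minus tendsto_divide tendsto_vec_nth z nz
        bounded_linear.tendsto[OF matrix_vector_mul_bounded_linear])
  also have "- ((A *v (s *\<^sub>R p)) $ l / (s *\<^sub>R p) $ l) = - \<Lambda>"
    using nz perron_vector(1) by (simp add: eigenvector_def matrix_vector_mult_scaleR)
  finally show ?thesis
  proof (rule Lim_transform_eventually)
    show "\<forall>\<^sub>F t in at_top. - ((A *v z t) $ l / z t $ l) = K (\<omega> t) u v"
      using eventually_ge_at_top[of 0]
    proof eventually_elim
      case (elim t)
      have "m2 (e l) \<noteq> 0" "\<omega> t (e l) \<noteq> 0" using m2_pos[of "e l"] pos[of "e l" t] elim by auto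
      then show ?case
        using matrix_y[OF l elim] by (simp add: z_def y_def matrix_vector_mult_scaleR)
    qed
  qed
qed

end

theorem theorem3p3:
  fixes V :: "'a set" and E :: "'a set set"
    and m1 :: "'a \<Rightarrow> real" and m2 :: "'a set \<Rightarrow> real"
    and e :: "'n::finite \<Rightarrow> 'a set"
    and \<omega>\<^sub>0 :: "'a set \<Rightarrow> real" and \<omega> :: "real \<Rightarrow> 'a set \<Rightarrow> real"
    and K :: "('a set \<Rightarrow> real) \<Rightarrow> 'a \<Rightarrow> 'a \<Rightarrow> real"
  assumes "connected_graph V E"
    and "bij_betw e UNIV E"
    and "\<And>x. x \<in> V \<Longrightarrow> 0 < m1 x"
    and "\<And>h. h \<in> E \<Longrightarrow> 0 < m2 h"
    and "\<And>h. h \<in> E \<Longrightarrow> 0 < \<omega>\<^sub>0 h"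
    and "K = forman_curvature E m1 m2 \<or> (tree V E \<and> K = lly_curvature V E m1 m2)"
    and "ricci_flow E K \<omega>\<^sub>0 \<omega>"
  shows "(\<forall>u v. {u, v} \<in> E \<longrightarrow>
            ((\<lambda>t. K (\<omega> t) u v) \<longlongrightarrow> - lambda_max (forman_matrix m1 m2 e)) at_top) \<and>
         (\<forall>l. ((\<lambda>t. \<omega> t (e l) / (\<Sum>h\<in>E. \<omega> t h)) \<longlongrightarrow>
            limit_coeff m1 m2 e \<omega>\<^sub>0 l / (\<Sum>h\<in>UNIV. limit_coeff m1 m2 e \<omega>\<^sub>0 h)) at_top)"
proof -
  \<comment> \<open>Either \<open>K\<close> is the Forman curvature by choice, or the graph is a
    tree and the curvatures agree on positive weights.\<close>
  have "K w u v = forman_curvature E m1 m2 w u v"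
    if w: "\<And>h. h \<in> E \<Longrightarrow> 0 < w h" and uv: "{u, v} \<in> E" for w u v
    using assms(6)
  proof
    assume lly: "tree V E \<and> K = lly_curvature V E m1 m2"
    then interpret weighted_tree V E w
      using assms(1) w by unfold_locales auto
    show ?thesis using lly_eq_forman[OF uv] assms(3,4) lly by blast
  qed simp
  then interpret forman_flow V E m1 m2 e K \<omega>\<^sub>0 \<omega>
    using assms by unfold_locales auto
  show ?thesis using curvature_limit normalized_weight_limit by blast
qed

end
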